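(* Let $m,\gamma,k_B,\omega,q_0>0$ and $T_0>T_1\ge 0$ be real constants. For a small parameter $\epsilon>0$ let $T(t)=T_0+\epsilon T_1\cos(\omega t)$. Set $$A_0=\begin{bmatrix}0&1\\-\frac{q_0}{m}&-\frac{\gamma}{m}\end{bmatrix},\qquad M=\begin{bmatrix}0&0\\0&\frac{2\gamma k_B}{m^2}\end{bmatrix}.$$ For a control $u$ (a $C^1$ function on $[0,\tfrac{2\pi}{\omega}]$ with $u(0)=u(\tfrac{2\pi}{\omega})$, extended periodically) let $U(t)=\begin{bmatrix}0&0\\-\frac{u(t)}{m}&0\end{bmatrix}$, and let the symmetric $2\times2$ matrix functions $\Sigma^{(0)}$ and $\Sigma^{(1)}=\Sigma^{(1)}_u$ be the $\tfrac{2\pi}{\omega}$-periodic solutions of $$\dot\Sigma^{(0)}=A_0\Sigma^{(0)}+\Sigma^{(0)}A_0'+T_0M,$$ $$\dot\Sigma^{(1)}=A_0\Sigma^{(1)}+\Sigma^{(1)}A_0'+U(t)\Sigma^{(0)}+\Sigma^{(0)}U(t)'+T_1\cos(\omega t)M.$$ Consider the optimal control problem $$\max_u\;-\frac{\omega}{4\pi}\int_0^{\frac{2\pi}{\omega}}\Big[\epsilon\,\dot u(t)\Sigma^{(0)}_{11}(t)+\epsilon^2\,\dot u(t)\big(\Sigma^{(1)}_u\big)_{11}(t)\Big]\,dt$$ over all such controls $u$. Then the maximum is attained by the optimal control law $$u^*(t)=q_1^*\cos(\omega t-\phi^* ),\qquad q_1^*=\frac{q_0\gamma T_1\sqrt{\alpha^2+\beta^2}}{T_0(2\gamma\beta-\alpha\omega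 m)},\qquad \phi^*=\angle(\beta-i\alpha),$$ where $\alpha=4q_0\gamma-3\omega^2\gamma m$ and $\beta=\omega(2\gamma^2+4q_0m-\omega^2m^2)$. Moreover, with this control the power output satisfies, as $\epsilon\to0$, $$\text{power}=\epsilon^2\,\frac{q_0\,\omega\,k_B\gamma^2T_1^2}{2T_0(2\gamma\beta-\alpha\omega m)}+O(\epsilon^3).$$
   Context: Here $\angle z$ denotes the argument of the nonzero complex number $z$, and $'$ denotes matrix transpose. The setting is the scalar underdamped Langevin system $dX_t=v_t\,dt$, $m\,dv_t=-q(t)X_t\,dt-\gamma v_t\,dt+\sqrt{2\gamma k_BT(t)}\,dB_t$ with quadratic potential $\frac12q(t)x^2$ and control gain $q(t)=q_0+\epsilon u(t)$. The $2\times2$ covariance matrix $\Sigma(t)$ of $(X_t,v_t)'$ obeys the Lyapunov equation $\dot\Sigma=A(t)\Sigma+\Sigma A(t)'+T(t)M$ with $A(t)=\begin{bmatrix}0&1\\-\frac{q(t)}{m}&-\frac{\gamma}{m}\end{bmatrix}$, and the process is cyclic, i.e. $\Sigma$ is the $\frac{2\pi}{\omega}$-periodic solution of this equation. The functions $\Sigma^{(0)},\Sigma^{(1)}$ are the zeroth- and first-order coefficients in the expansion $\Sigma=\Sigma^{(0)}+\epsilon\Sigma^{(1)}+O(\epsilon^2)$. The power output of a control $u$ is the average extracted work per unit time over a cycle, $$\text{power}=-\frac{\omega}{4\pi}\int_0^{\frac{2\pi}{\omega}}\epsilon\,\dot u(t)\,\Sigma_{11}(t)\,dt,$$ where $\Sigma$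 is the exact periodic covariance for $q=q_0+\epsilon u$ (which exists and is unique for $\epsilon$ small). *)

theory Defs
  imports "HOL-Analysis.Analysis" "HOL-Library.Landau_Symbols"
begin

definition mat2 :: "real \<Rightarrow> real \<Rightarrow> real \<Rightarrow> real \<Rightarrow> real ^ 2 ^ 2" where
  "mat2 a b c d = vector [vector [a, b], vector [c, d]]"

definition drift_matrix :: "real \<Rightarrow> real \<Rightarrow> real \<Rightarrow> real ^ 2 ^ 2" where
  "drift_matrix m \<gamma> q = mat2 0 1 (- q / m) (- \<gamma> / m)"

definition noise_matrix :: "real \<Rightarrow> real \<Rightarrow> real \<Rightarrow> real ^ 2 ^ 2" where
  "noise_matrix m \<gamma> kB = mat2 0 0 0 (2 * \<gamma> * kB / m\<^sup>2)"

definition gain_matrix :: "real \<Rightarrow> real \<Rightarrow> real ^ 2 ^ 2" where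
  "gain_matrix m v = mat2 0 0 (- v / m) 0"

definition periodic_lyapunov_solution ::
  "real \<Rightarrow> (real \<Rightarrow> real ^ 2 ^ 2) \<Rightarrow> (real \<Rightarrow> real ^ 2 ^ 2) \<Rightarrow> (real \<Rightarrow> real ^ 2 ^ 2) \<Rightarrow> bool" where
  "periodic_lyapunov_solution p A Q S \<longleftrightarrow>
     (\<forall>t. S (t + p) = S t) \<and>
     (\<forall>t. transpose (S t) = S t) \<and>
     (\<forall>t. (S has_vector_derivative (A t ** S t + S t ** transpose (A t) + Q t)) (at t))"

text \<open>
  The derivative of a control is taken within one closed period, hence is one-sided at the
  endpoints: a control is \<open>C\<^sup>1\<close> on the closed period, but its periodic extension to the real line
  may have a corner at the multiples of the period.  A control is represented by this extension;
  periodicity subsumes equality of the values at the two endpoints.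
\<close>

definition control_deriv :: "real \<Rightarrow> (real \<Rightarrow> real) \<Rightarrow> real \<Rightarrow> real" where
  "control_deriv \<omega> u t = vector_derivative u (at t within {0..2 * pi / \<omega>})"

definition admissible_control :: "real \<Rightarrow> (real \<Rightarrow> real) \<Rightarrow> bool" where
  "admissible_control \<omega> u \<longleftrightarrow>
     (\<forall>t. u (t + 2 * pi / \<omega>) = u t) \<and>
     u differentiable_on {0..2 * pi / \<omega>} \<and>
     continuous_on {0..2 * pi / \<omega>} (control_deriv \<omega> u)"

definition is_sigma0 ::
  "real \<Rightarrow> real \<Rightarrow> real \<Rightarrow> real \<Rightarrow> real \<Rightarrow> real \<Rightarrow> (real \<Rightarrow> real ^ 2 ^ 2) \<Rightarrow> bool" where
  "is_sigma0 m \<gamma> kB \<omega> q0 T0 =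
     periodic_lyapunov_solution (2 * pi / \<omega>)
       (\<lambda>t. drift_matrix m \<gamma> q0)
       (\<lambda>t. T0 *\<^sub>R noise_matrix m \<gamma> kB)"

definition sigma0 ::
  "real \<Rightarrow> real \<Rightarrow> real \<Rightarrow> real \<Rightarrow> real \<Rightarrow> real \<Rightarrow> real \<Rightarrow> real ^ 2 ^ 2" where
  "sigma0 m \<gamma> kB \<omega> q0 T0 = (THE S. is_sigma0 m \<gamma> kB \<omega> q0 T0 S)"

definition is_sigma1 ::
  "real \<Rightarrow> real \<Rightarrow> real \<Rightarrow> real \<Rightarrow> real \<Rightarrow> real \<Rightarrow> real \<Rightarrow> (real \<Rightarrow> real) \<Rightarrow>
     (real \<Rightarrow> real ^ 2 ^ 2) \<Rightarrow> bool" where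
  "is_sigma1 m \<gamma> kB \<omega> q0 T0 T1 u =
     periodic_lyapunov_solution (2 * pi / \<omega>)
       (\<lambda>t. drift_matrix m \<gamma> q0)
       (\<lambda>t. gain_matrix m (u t) ** sigma0 m \<gamma> kB \<omega> q0 T0 t
          + sigma0 m \<gamma> kB \<omega> q0 T0 t ** transpose (gain_matrix m (u t))
          + (T1 * cos (\<omega> * t)) *\<^sub>R noise_matrix m \<gamma> kB)"

definition sigma1 ::
  "real \<Rightarrow> real \<Rightarrow> real \<Rightarrow> real \<Rightarrow> real \<Rightarrow> real \<Rightarrow> real \<Rightarrow> (real \<Rightarrow> real) \<Rightarrow> real \<Rightarrow> real ^ 2 ^ 2" where
  "sigma1 m \<gamma> kB \<omega> q0 T0 T1 u = (THE S. is_sigma1 m \<gamma> kB \<omega> q0 T0 T1 u S)"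

definition is_cyclic_covariance ::
  "real \<Rightarrow> real \<Rightarrow> real \<Rightarrow> real \<Rightarrow> real \<Rightarrow> real \<Rightarrow> real \<Rightarrow> real \<Rightarrow> (real \<Rightarrow> real) \<Rightarrow>
     (real \<Rightarrow> real ^ 2 ^ 2) \<Rightarrow> bool" where
  "is_cyclic_covariance m \<gamma> kB \<omega> q0 T0 T1 \<epsilon> u =
     periodic_lyapunov_solution (2 * pi / \<omega>)
       (\<lambda>t. drift_matrix m \<gamma> (q0 + \<epsilon> * u t))
       (\<lambda>t. (T0 + \<epsilon> * T1 * cos (\<omega> * t)) *\<^sub>R noise_matrix m \<gamma> kB)"

definition cyclic_covariance ::
  "real \<Rightarrow> real \<Rightarrow> real \<Rightarrow> real \<Rightarrow> real \<Rightarrow> real \<Rightarrow> real \<Rightarrow> real \<Rightarrow> (real \<Rightarrow> real) \<Rightarrow>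
     real \<Rightarrow> real ^ 2 ^ 2" where
  "cyclic_covariance m \<gamma> kB \<omega> q0 T0 T1 \<epsilon> u =
     (THE S. is_cyclic_covariance m \<gamma> kB \<omega> q0 T0 T1 \<epsilon> u S)"

definition second_order_objective ::
  "real \<Rightarrow> real \<Rightarrow> real \<Rightarrow> real \<Rightarrow> real \<Rightarrow> real \<Rightarrow> real \<Rightarrow> real \<Rightarrow> (real \<Rightarrow> real) \<Rightarrow> real" where
  "second_order_objective m \<gamma> kB \<omega> q0 T0 T1 \<epsilon> u =
     - (\<omega> / (4 * pi)) * integral {0..2 * pi / \<omega>}
         (\<lambda>t. \<epsilon> * control_deriv \<omega> u t * sigma0 m \<gamma> kB \<omega> q0 T0 t $ 1 $ 1
            + \<epsilon>\<^sup>2 * control_deriv \<omega> u t * sigma1 m \<gamma> kB \<omega> q0 T0 T1 u t $ 1 $ 1)"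

definition power_output ::
  "real \<Rightarrow> real \<Rightarrow> real \<Rightarrow> real \<Rightarrow> real \<Rightarrow> real \<Rightarrow> real \<Rightarrow> real \<Rightarrow> (real \<Rightarrow> real) \<Rightarrow> real" where
  "power_output m \<gamma> kB \<omega> q0 T0 T1 \<epsilon> u =
     - (\<omega> / (4 * pi)) * integral {0..2 * pi / \<omega>}
         (\<lambda>t. \<epsilon> * control_deriv \<omega> u t * cyclic_covariance m \<gamma> kB \<omega> q0 T0 T1 \<epsilon> u t $ 1 $ 1)"

end

theory Submission
  imports Defs
begin

text \<open>
  For a symmetric \<open>\<Sigma>\<close> the Lyapunov equation is a linear system in the entries
  \<open>x = \<Sigma>\<^sub>1\<^sub>1\<close>, \<open>y = \<Sigma>\<^sub>1\<^sub>2\<close>, \<open>z = \<Sigma>\<^sub>2\<^sub>2\<close>.  With the eigenvalues of the drift it becomes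
  triangular over the complex numbers, so unique periodic solutions and a bound in terms of the
  forcing come from scalar equations \<open>w' = \<mu> w + g\<close> with \<open>Re \<mu> < 0\<close>.  The gain \<open>q\<^sub>0 + \<epsilon> u\<close> is a
  Lipschitz perturbation: the Banach fixed point theorem gives the exact cyclic covariance, and the
  bound applied to \<open>\<Sigma> - \<Sigma>\<^sup>(\<^sup>0\<^sup>) - \<epsilon> \<Sigma>\<^sup>(\<^sup>1\<^sup>)\<close> gives an error of order \<open>\<epsilon>\<^sup>2\<close>, hence \<open>\<epsilon>\<^sup>3\<close> for the power.

  For the optimization no Fourier series is needed: multiplying the equations for \<open>y\<close> and \<open>z\<close> by
  \<open>y\<close> and \<open>z\<close> turns the extracted work into a concave functional of \<open>(y, z)\<close>, up to exact
  derivatives.  Its stationarity condition is solved by an explicit sinusoid, and completing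
  the square shows that this sinusoid is optimal.
\<close>

subsection \<open>Periodic solutions of scalar equations\<close>

text \<open>Keeping the linear part \<open>L\<close> apart from the forcing \<open>g\<close> lets
  one notion cover the complex scalar equations, the moment system, and state-dependent problems in
  which \<open>g\<close> is built from \<open>s\<close> itself.\<close>

definition periodic_solution ::
  "real \<Rightarrow> ('a \<Rightarrow> 'a) \<Rightarrow> (real \<Rightarrow> 'a) \<Rightarrow> (real \<Rightarrow> 'a :: real_normed_vector) \<Rightarrow> bool" where
  "periodic_solution p L g s \<longleftrightarrow>
     (\<forall>t. s (t + p) = s t) \<and> (\<forall>t. (s has_vector_derivative (L (s t) + g t)) (at t))"

lemma periodic_solutionD:
  assumes "periodic_solution p L g s"
  shows "s (t + p) = s t" and "(s has_vector_derivative (L (s t) + g t)) (at t)"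
  using assms by (auto simp: periodic_solution_def)

lemma periodic_solution_continuous:
  assumes "periodic_solution p L g s"
  shows "continuous_on A s"
  using periodic_solutionD(2)[OF assms]
  by (meson continuous_at_imp_continuous_on has_vector_derivative_continuous)

lemma periodic_shift_into_period:
  fixes f :: "real \<Rightarrow> 'a"
  assumes "p > 0" and "\<And>t. f (t + p) = f t"
  obtains t' where "0 \<le> t'" and "t' < p" and "f t' = f t"
proof -
  interpret periodic_fun_simple f p
    using assms(2) by unfold_locales
  define n where "n = \<lfloor>t / p\<rfloor>"
  have "of_int n \<le> t / p" and "t / p < of_int n + 1"
    unfolding n_def by linarith+
  then have "0 \<le> t - of_int n * p" and "t - of_int n * p < p"
    using \<open>p > 0\<close> by (simp_all add: field_simps)
  then show ?thesis
    using that[of "t - of_int n * p"] by (simp add: minus_of_int)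
qed

lemma periodic_attains_norm_max:
  fixes f :: "real \<Rightarrow> 'a :: real_normed_vector"
  assumes "p > 0" and "\<And>t. f (t + p) = f t" and "continuous_on UNIV f"
  obtains t0 where "\<And>t. norm (f t) \<le> norm (f t0)"
proof -
  have "continuous_on {0..p} (\<lambda>t. norm (f t))"
    using assms(3) by (intro continuous_intros) (auto intro: continuous_on_subset)
  then obtain t0 where t0: "\<And>t. t \<in> {0..p} \<Longrightarrow> norm (f t) \<le> norm (f t0)"
    using continuous_attains_sup[of "{0..p}" "\<lambda>t. norm (f t)"] \<open>p > 0\<close>
    by (metis atLeastatMost_empty_iff2 compact_Icc less_imp_le order_less_irrefl order_less_le_trans)
  have "norm (f t) \<le> norm (f t0)" for t
    using periodic_shift_into_period[of p f t] assms(1,2) t0 by (metis atLeastAtMost_iff less_imp_le)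
  then show ?thesis using that by blast
qed

text \<open>Controls are known to be continuous only on one closed period, whereas the existence
  results need forcing continuous on the whole line. Adjacent translates agree at their common
  endpoint, so they can be glued.\<close>

lemma periodic_continuous_on_UNIV:
  fixes f :: "real \<Rightarrow> 'a :: topological_space"
  assumes "p > 0" and per: "\<And>t. f (t + p) = f t" and cont: "continuous_on {0..p} f"
  shows "continuous_on UNIV f"
proof -
  interpret periodic_fun_simple f p
    using per by unfold_locales
  have shifted: "continuous_on {of_int n * p..of_int n * p + p} f" for n
  proof -
    have "continuous_on {of_int n * p..of_int n * p + p} (\<lambda>t. f (t - of_int n * p))"
      by (rule continuous_on_compose2[OF cont]) (auto intro!: continuous_intros)
    then show ?thesis by (simp add: minus_of_int)
  qed
  have "isCont f t" for t
  proof -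
    define n where "n = \<lfloor>t / p\<rfloor>"
    have "of_int n \<le> t / p" and "t / p < of_int n + 1"
      unfolding n_def by linarith+
    then have n: "of_int n * p \<le> t" "t < of_int n * p + p"
      using \<open>p > 0\<close> by (simp_all add: field_simps)
    \<comment> \<open>The preceding period is included because \<open>t\<close> may be the left
      endpoint of its own period; it is interior to the union.\<close>
    have "continuous_on ({of_int (n - 1) * p..of_int (n - 1) * p + p} \<union> {of_int n * p..of_int n * p + p}) f"
      by (intro continuous_on_closed_Un shifted) auto
    then have "continuous_on {of_int n * p - p<..<of_int n * p + p} f"
      by (rule continuous_on_subset) (auto simp: algebra_simps)
    then show "isCont f t"
      using n \<open>p > 0\<close> by (auto simp: continuous_on_eq_continuous_at)
  qed
  then show ?thesis by (simp add: continuous_at_imp_continuous_on)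
qed

lemma continuous_antiderivative:
  fixes f :: "real \<Rightarrow> 'a :: euclidean_space"
  assumes "continuous_on UNIV f"
  obtains F where "\<And>t. (F has_vector_derivative f t) (at t)"
proof
  \<comment> \<open>The oriented integral makes this an antiderivative for negative \<open>t\<close>
    as well.\<close>
  define F where "F t = interval_lebesgue_integral lborel (ereal 0) (ereal t) f" for t
  show "(F has_vector_derivative f t) (at t)" for t
  proof -
    let ?a = "min t 0 - 1" and ?b = "max t 0 + 1"
    have "(F has_vector_derivative f t) (at t within {?a..?b})"
      unfolding F_def using assms
      by (intro interval_integral_FTC2) (auto intro: continuous_on_subset)
    then have "(F has_vector_derivative f t) (at t within {?a<..<?b})"
      by (rule has_vector_derivative_within_subset) auto
    moreover have "at t within {?a<..<?b} = at t"
      by (rule at_within_open) auto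
    ultimately show ?thesis by simp
  qed
qed

text \<open>At a maximum of the squared modulus its derivative vanishes, which bounds the modulus there.\<close>

lemma scalar_periodic_solution_bound:
  fixes \<mu> :: complex and w :: "real \<Rightarrow> complex"
  assumes "p > 0" and "Re \<mu> < 0" and w: "periodic_solution p ((*) \<mu>) g w"
    and g: "\<And>t. norm (g t) \<le> B"
  shows "norm (w t) \<le> B / (- Re \<mu>)"
proof -
  obtain t0 where t0: "\<And>t. norm (w t) \<le> norm (w t0)"
    using periodic_attains_norm_max[OF \<open>p > 0\<close>, of w] periodic_solutionD(1)[OF w]
      periodic_solution_continuous[OF w] by blast
  have "((\<lambda>t. w t \<bullet> w t) has_vector_derivative
      (w t0 \<bullet> (\<mu> * w t0 + g t0) + (\<mu> * w t0 + g t0) \<bullet> w t0)) (at t0)"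
    using bounded_bilinear.has_vector_derivative[OF bounded_bilinear_inner
        periodic_solutionD(2)[OF w] periodic_solutionD(2)[OF w]] .
  then have "((\<lambda>t. w t \<bullet> w t) has_real_derivative (2 * (w t0 \<bullet> (\<mu> * w t0 + g t0)))) (at t0)"
    by (simp add: has_real_derivative_iff_has_vector_derivative inner_commute)
  moreover have "\<forall>t. \<bar>t0 - t\<bar> < 1 \<longrightarrow> w t \<bullet> w t \<le> w t0 \<bullet> w t0"
    using t0 by (simp add: dot_square_norm)
  ultimately have "w t0 \<bullet> (\<mu> * w t0 + g t0) = 0"
    using DERIV_local_max[of "\<lambda>t. w t \<bullet> w t" _ t0 1] by fastforce
  moreover have "w t0 \<bullet> (\<mu> * w t0) = Re \<mu> * (norm (w t0))\<^sup>2"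
    by (simp add: inner_complex_def cmod_power2 algebra_simps) (simp add: power2_eq_square)
  ultimately have "- Re \<mu> * (norm (w t0))\<^sup>2 = w t0 \<bullet> g t0"
    by (simp add: inner_add_right)
  also have "\<dots> \<le> norm (w t0) * norm (g t0)"
    by (rule norm_cauchy_schwarz)
  also have "\<dots> \<le> norm (w t0) * B"
    by (intro mult_left_mono g) auto
  finally have *: "norm (w t0) * (- Re \<mu> * norm (w t0)) \<le> norm (w t0) * B"
    by (simp add: power2_eq_square algebra_simps)
  \<comment> \<open>The factor \<open>norm (w t0)\<close> can be cancelled only if it is nonzero;
    otherwise the claim is \<open>0 \<le> B\<close>, which holds because \<open>B\<close> bounds a
    norm.\<close>
  have "- Re \<mu> * norm (w t0) \<le> B"
  proof (cases "w t0 = 0")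
    case True
    then show ?thesis using order_trans[OF norm_ge_zero g[of t0]] by simp
  next
    case False
    then show ?thesis using * by (metis mult_le_cancel_left_pos zero_less_norm_iff)
  qed
  then have "norm (w t0) \<le> B / (- Re \<mu>)"
    using \<open>Re \<mu> < 0\<close> by (simp add: field_simps)
  then show ?thesis using t0 order_trans by blast
qed

text \<open>Variation of constants: every \<open>E t * (c + H t)\<close> solves the equation, and
  \<open>c\<close> is left to match the values at 0 and \<open>p\<close>. This is possible because
  \<open>Re \<mu> < 0\<close> gives \<open>norm (E p) < 1\<close>, hence
  \<open>E p \<noteq> 1\<close>.\<close>

lemma scalar_periodic_solution_exists:
  fixes \<mu> :: complex and g :: "real \<Rightarrow> complex"
  assumes "p > 0" and "Re \<mu> < 0" and "continuous_on UNIV g" and per: "\<And>t. g (t + p) = g t"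
  shows "\<exists>w. periodic_solution p ((*) \<mu>) g w"
proof -
  define E where "E t = exp (t *\<^sub>R \<mu>)" for t
  have dE: "(E has_vector_derivative (\<mu> * E t)) (at t within A)" for t A
    unfolding E_def 
    by (rule has_vector_derivative_at_within[OF exp_scaleR_has_vector_derivative_left])
  have E_minus: "E t * E (- t) = 1" for t
    unfolding E_def by (simp flip: exp_add)
  have E_add: "E (s + t) = E s * E t" for s t
    unfolding E_def by (simp add: exp_add scaleR_left_distrib)
  have "continuous_on UNIV (\<lambda>t. E (- t) * g t)"
    unfolding E_def by (intro continuous_intros assms)
  then obtain H where dH: "\<And>t. (H has_vector_derivative (E (- t) * g t)) (at t)"
    using continuous_antiderivative by blast
  have "norm (E p) < 1"
    unfolding E_def using assms(1,2) by (simp add: mult_pos_neg)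
  then have "E p \<noteq> 1" by auto
  \<comment> \<open>The solution of \<open>E p * (c + H p) = c + H 0\<close>, that is, of
    \<open>w p = w 0\<close>.\<close>
  define c where "c = (H 0 - E p * H p) / (E p - 1)"
  define w where "w t = E t * (c + H t)" for t
  have dw: "(w has_vector_derivative (\<mu> * w t + g t)) (at t)" for t
  proof -
    have "(w has_vector_derivative (E t * (0 + E (- t) * g t) + \<mu> * E t * (c + H t))) (at t)"
      unfolding w_def by (intro has_vector_derivative_mult has_vector_derivative_add dE dH
          has_vector_derivative_const)
    moreover have "E t * (0 + E (- t) * g t) = g t"
      using E_minus[of t] by (simp flip: mult.assoc)
    moreover have "\<mu> * E t * (c + H t) = \<mu> * w t"
      by (simp add: w_def mult.assoc)
    ultimately show ?thesis by (metis add.commute)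
  qed
  have "c * (E p - 1) = H 0 - E p * H p"
    using \<open>E p \<noteq> 1\<close> by (simp add: c_def)
  then have wp: "w p = w 0"
    by (simp add: w_def E_def algebra_simps)
  have "w (t + p) = w t" for t
  proof -
    \<comment> \<open>The difference between \<open>w\<close> and its shift solves the homogeneous
      equation, so multiplying it by the integrating factor gives a constant, which
      \<open>w p = w 0\<close> forces to be zero.\<close>
    define d where "d t = E (- t) * (w (t + p) - w t)" for t
    have "(d has_vector_derivative 0) (at t)" for t
    proof -
      have 1: "((\<lambda>t. E (- t)) has_vector_derivative - (\<mu> * E (- t))) (at t)"
        using vector_diff_chain_at[OF has_vector_derivative_minus[OF has_vector_derivative_id] dE, of t]
        by (simp add: o_def)
      have 2: "((\<lambda>t. w (t + p)) has_vector_derivative (\<mu> * w (t + p) + g (t + p))) (at t)"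
        using vector_diff_chain_at[OF has_vector_derivative_add[OF has_vector_derivative_id
              has_vector_derivative_const] dw, of p t]
        by (simp add: o_def)
      show ?thesis
        unfolding d_def
        by (rule has_vector_derivative_eq_rhs,
            rule has_vector_derivative_mult[OF 1 has_vector_derivative_diff[OF 2 dw]])
          (use per[of t] in \<open>simp add: algebra_simps\<close>)
    qed
    then obtain k where k: "\<And>t. d t = k"
      using has_vector_derivative_zero_constant[of UNIV d] by auto
    have "k = 0" using k[of 0] wp by (simp add: d_def)
    moreover have "E (- t) \<noteq> 0" by (simp add: E_def)
    ultimately show ?thesis using k[of t] by (simp add: d_def)
  qed
  then show ?thesis using dw by (auto simp: periodic_solution_def)
qed

subsection \<open>The moment equations\<close>

lemma has_vector_derivative_Pair_iff:
  "(s has_vector_derivative (a, b)) (at t within A) \<longleftrightarrow>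
     ((\<lambda>t. fst (s t)) has_vector_derivative a) (at t within A) \<and>
     ((\<lambda>t. snd (s t)) has_vector_derivative b) (at t within A)"
proof
  assume s: "(s has_vector_derivative (a, b)) (at t within A)"
  show "((\<lambda>t. fst (s t)) has_vector_derivative a) (at t within A) \<and>
     ((\<lambda>t. snd (s t)) has_vector_derivative b) (at t within A)"
    using bounded_linear.has_vector_derivative[OF bounded_linear_fst s]
      bounded_linear.has_vector_derivative[OF bounded_linear_snd s] by simp
next
  assume "((\<lambda>t. fst (s t)) has_vector_derivative a) (at t within A) \<and>
     ((\<lambda>t. snd (s t)) has_vector_derivative b) (at t within A)"
  then show "(s has_vector_derivative (a, b)) (at t within A)"
    using has_derivative_Pair[of "\<lambda>t. fst (s t)" _ t A "\<lambda>t. snd (s t)"]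
    by (auto simp: has_vector_derivative_def)
qed

text \<open>The triple holds the entries \<open>(\<Sigma>\<^sub>1\<^sub>1, \<Sigma>\<^sub>1\<^sub>2, \<Sigma>\<^sub>2\<^sub>2)\<close>, with \<open>a = \<gamma> / m\<close> and \<open>k = q\<^sub>0 / m\<close>.\<close>

definition moment_map :: "real \<Rightarrow> real \<Rightarrow> real \<times> real \<times> real \<Rightarrow> real \<times> real \<times> real" where
  "moment_map a k = (\<lambda>(x, y, z). (2 * y, z - k * x - a * y, - 2 * k * y - 2 * a * z))"

lemma linear_moment_map: "linear (moment_map a k)"
  by (rule linearI) (auto simp: moment_map_def algebra_simps split: prod.splits)

text \<open>Here \<open>l\<close> and \<open>r\<close> are the roots of
  \<open>X\<^sup>2 + a X + k\<close>, the characteristic polynomial of the drift. A root with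
  nonnegative real part would have to be real, and then
  \<open>k = - a * Re x - (Re x)\<^sup>2\<close> could not be positive.\<close>

lemma stable_quadratic_roots:
  fixes a k :: real
  assumes "a > 0" and "k > 0"
  obtains l r :: complex where "complex_of_real a = - (l + r)" and "complex_of_real k = l * r"
    and "Re l < 0" and "Re r < 0"
proof -
  define d where "d = csqrt ((of_real a)\<^sup>2 - 4 * of_real k)"
  define l r where "l = (- of_real a + d) / 2" and "r = (- of_real a - d) / 2"
  have d2: "d\<^sup>2 = (of_real a)\<^sup>2 - 4 * of_real k"
    unfolding d_def by (rule power2_csqrt)
  have sum: "complex_of_real a = - (l + r)"
    by (simp add: l_def r_def field_simps)
  have "l * r = ((of_real a)\<^sup>2 - d\<^sup>2) / 4"
    by (simp add: l_def r_def power2_eq_square field_simps)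
  then have prod: "complex_of_real k = l * r"
    by (simp add: d2)
  \<comment> \<open>Stated for any pair with this sum and product, so that swapping the arguments
    covers the second root.\<close>
  have neg: "Re x < 0" if "complex_of_real a = - (x + y)" "complex_of_real k = x * y" for x y
  proof (rule ccontr)
    assume "\<not> Re x < 0"
    have y: "y = - of_real a - x" by (simp add: that(1))
    have im: "Im x * (2 * Re x + a) = 0" and re: "k = - a * Re x - (Re x)\<^sup>2 + (Im x)\<^sup>2"
      using arg_cong[OF that(2), of Im] arg_cong[OF that(2), of Re]
      by (simp_all add: y algebra_simps power2_eq_square)
    have "Im x = 0" using im \<open>a > 0\<close> \<open>\<not> Re x < 0\<close> by auto
    moreover have "a * Re x \<ge> 0" using \<open>a > 0\<close> \<open>\<not> Re x < 0\<close> by simp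
    ultimately show False using re \<open>k > 0\<close> zero_le_power2[of "Re x"] by simp
  qed
  show ?thesis
    using that[OF sum prod neg[OF sum prod]] neg[of r l] sum prod by (simp add: ac_simps)
qed

text \<open>
  With \<open>l\<close>, \<open>r\<close> the eigenvalues of the drift, the variables \<open>x\<close>, \<open>y - l x\<close>,
  \<open>z - 2 l y + l\<^sup>2 x\<close> make the moment equations triangular, even for a double eigenvalue.
\<close>

lemma moment_map_solution_bound:
  assumes "a > 0" and "k > 0" and "p > 0"
  obtains C where "C \<ge> 0" and
    "\<And>g s B t. periodic_solution p (moment_map a k) g s \<Longrightarrow> (\<And>t. norm (g t) \<le> B) \<Longrightarrow>
       norm (s t) \<le> C * B"
proof -
  obtain l r where a: "complex_of_real a = - (l + r)" and k: "complex_of_real k = l * r"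
    and lr: "Re l < 0" "Re r < 0"
    using stable_quadratic_roots[OF assms(1,2)] by metis
  \<comment> \<open>These are the scalar bounds obtained by solving the triangular system in the
    order \<open>w2\<close>, \<open>w1\<close>, \<open>x\<close>, with rates \<open>2 * r\<close>,
    \<open>l + r = - a\<close> and \<open>2 * l\<close>; \<open>Cy\<close> and \<open>Cz\<close>
    undo the change of variables. They depend only on \<open>a\<close>, \<open>l\<close> and
    \<open>r\<close>, so the bound is uniform in the forcing.\<close>
  define C2 where "C2 = (1 + 2 * cmod l + (cmod l)\<^sup>2) / (- Re (2 * r))"
  define C1 where "C1 = (1 + cmod l + C2) / (- Re (of_real (- a)))"
  define Cx where "Cx = (1 + 2 * C1) / (- Re (2 * l))"
  define Cy where "Cy = C1 + cmod l * Cx"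
  define Cz where "Cz = C2 + 2 * cmod l * Cy + (cmod l)\<^sup>2 * Cx"
  have nonneg: "C2 \<ge> 0" "C1 \<ge> 0" "Cx \<ge> 0" "Cy \<ge> 0" "Cz \<ge> 0"
  proof -
    show "C2 \<ge> 0" unfolding C2_def using lr by (intro divide_nonneg_nonneg) auto
    then show "C1 \<ge> 0" unfolding C1_def using assms by (intro divide_nonneg_nonneg) auto
    then show "Cx \<ge> 0" unfolding Cx_def using lr by (intro divide_nonneg_nonneg) auto
    then show "Cy \<ge> 0" unfolding Cy_def using \<open>C1 \<ge> 0\<close> by simp
    then show "Cz \<ge> 0" unfolding Cz_def using \<open>C2 \<ge> 0\<close> \<open>Cx \<ge> 0\<close> by simp
  qed
  have "norm (s t) \<le> (Cx + Cy + Cz) * B"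
    if s: "periodic_solution p (moment_map a k) g s" and B: "\<And>t. norm (g t) \<le> B" for g s B t
  proof -
    define x y z where "x t = complex_of_real (fst (s t))"
      and "y t = complex_of_real (fst (snd (s t)))" and "z t = complex_of_real (snd (snd (s t)))" for t
    define g1 g2 g3 where "g1 t = complex_of_real (fst (g t))"
      and "g2 t = complex_of_real (fst (snd (g t)))" and "g3 t = complex_of_real (snd (snd (g t)))" for t
    have gB: "cmod (g1 t) \<le> B" "cmod (g2 t) \<le> B" "cmod (g3 t) \<le> B" for t
      using B[of t] norm_fst_le[of "fst (g t)" "snd (g t)"] norm_snd_le[of "snd (g t)" "fst (g t)"]
        norm_fst_le[of "fst (snd (g t))" "snd (snd (g t))"]
        norm_snd_le[of "snd (snd (g t))" "fst (snd (g t))"]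
      unfolding g1_def g2_def g3_def by auto
    have ds: "(s has_vector_derivative
        (2 * fst (snd (s t)) + fst (g t),
         (snd (snd (s t)) - k * fst (s t) - a * fst (snd (s t))) + fst (snd (g t)),
         (- 2 * k * fst (snd (s t)) - 2 * a * snd (snd (s t))) + snd (snd (g t)))) (at t)" for t
      using periodic_solutionD(2)[OF s, of t]
      by (simp add: moment_map_def case_prod_beta plus_prod_def)
    note ds' = ds[unfolded has_vector_derivative_Pair_iff]
    have dx: "(x has_vector_derivative (2 * y t + g1 t)) (at t)" for t
      using bounded_linear.has_vector_derivative[OF bounded_linear_of_real[where 'a = complex] conjunct1[OF ds'[of t]]]
      by (simp add: x_def[abs_def] y_def g1_def)
    have dy: "(y has_vector_derivative (z t - l * r * x t + (l + r) * y t + g2 t)) (at t)" for t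
      using bounded_linear.has_vector_derivative[OF bounded_linear_of_real[where 'a = complex] conjunct1[OF conjunct2[OF ds'[of t]]]]
      by (simp add: x_def y_def[abs_def] z_def g2_def a k algebra_simps)
    have dz: "(z has_vector_derivative (- 2 * (l * r) * y t + 2 * (l + r) * z t + g3 t)) (at t)" for t
      using bounded_linear.has_vector_derivative[OF bounded_linear_of_real[where 'a = complex] conjunct2[OF conjunct2[OF ds'[of t]]]]
      by (simp add: y_def z_def[abs_def] g3_def a k algebra_simps)
    have per: "x (t + p) = x t" "y (t + p) = y t" "z (t + p) = z t" for t
      using periodic_solutionD(1)[OF s] by (simp_all add: x_def y_def z_def)
    define w1 w2 where "w1 t = y t - l * x t" and "w2 t = z t - 2 * l * y t + l\<^sup>2 * x t" for t
    have "periodic_solution p ((*) (2 * r)) (\<lambda>t. g3 t - 2 * l * g2 t + l\<^sup>2 * g1 t) w2"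
      unfolding periodic_solution_def w2_def
      by (intro conjI allI, simp add: per, rule has_vector_derivative_eq_rhs,
          (rule has_vector_derivative_add has_vector_derivative_diff
            has_vector_derivative_mult_right dx dy dz)+,
          simp add: algebra_simps power2_eq_square)
    moreover have "cmod (g3 t - 2 * l * g2 t + l\<^sup>2 * g1 t) \<le> (1 + 2 * cmod l + (cmod l)\<^sup>2) * B" for t
    proof -
      have "cmod (g3 t - 2 * l * g2 t + l\<^sup>2 * g1 t)
          \<le> cmod (g3 t) + cmod (2 * l * g2 t) + cmod (l\<^sup>2 * g1 t)"
        by (intro norm_triangle_mono norm_triangle_ineq4 order_refl)
      also have "\<dots> \<le> B + 2 * cmod l * B + (cmod l)\<^sup>2 * B"
        using gB[of t] by (intro add_mono) (auto simp: norm_mult norm_power intro!: mult_left_mono)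
      finally show ?thesis by (simp add: algebra_simps)
    qed
    ultimately have w2: "cmod (w2 t) \<le> C2 * B" for t
      using scalar_periodic_solution_bound[OF \<open>p > 0\<close>, of "2 * r"] lr unfolding C2_def by auto
    have "periodic_solution p ((*) (of_real (- a))) (\<lambda>t. w2 t + (g2 t - l * g1 t)) w1"
      unfolding periodic_solution_def w1_def
      by (intro conjI allI, simp add: per, rule has_vector_derivative_eq_rhs,
          (rule has_vector_derivative_add has_vector_derivative_diff
            has_vector_derivative_mult_right dx dy dz)+,
          simp add: w2_def a algebra_simps power2_eq_square)
    moreover have "cmod (w2 t + (g2 t - l * g1 t)) \<le> (1 + cmod l + C2) * B" for t
    proof -
      have "cmod (w2 t + (g2 t - l * g1 t)) \<le> cmod (w2 t) + (cmod (g2 t) + cmod (l * g1 t))"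
        by (intro norm_triangle_mono norm_triangle_ineq4 order_refl)
      also have "\<dots> \<le> C2 * B + (B + cmod l * B)"
        using gB[of t] w2 by (intro add_mono) (auto simp: norm_mult intro!: mult_left_mono)
      finally show ?thesis by (simp add: algebra_simps)
    qed
    ultimately have w1: "cmod (w1 t) \<le> C1 * B" for t
      using scalar_periodic_solution_bound[OF \<open>p > 0\<close>, of "of_real (- a)"] \<open>a > 0\<close>
      unfolding C1_def by auto
    have "periodic_solution p ((*) (2 * l)) (\<lambda>t. 2 * w1 t + g1 t) x"
      unfolding periodic_solution_def
      by (intro conjI allI, simp add: per, rule has_vector_derivative_eq_rhs[OF dx],
          simp add: w1_def algebra_simps)
    moreover have "cmod (2 * w1 t + g1 t) \<le> (1 + 2 * C1) * B" for t
      using norm_triangle_ineq[of "2 * w1 t" "g1 t"] w1[of t] gB(1)[of t]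
      by (simp add: norm_mult algebra_simps)
    ultimately have x: "cmod (x t) \<le> Cx * B" for t
      using scalar_periodic_solution_bound[OF \<open>p > 0\<close>, of "2 * l"] lr unfolding Cx_def by auto
    have y: "cmod (y t) \<le> Cy * B" for t
    proof -
      have "y t = w1 t + l * x t" by (simp add: w1_def)
      then have "cmod (y t) \<le> cmod (w1 t) + cmod l * cmod (x t)"
        using norm_triangle_ineq[of "w1 t" "l * x t"] by (simp add: norm_mult)
      also have "\<dots> \<le> C1 * B + cmod l * (Cx * B)"
        by (intro add_mono mult_left_mono w1 x) auto
      finally show ?thesis by (simp add: Cy_def algebra_simps)
    qed
    have z: "cmod (z t) \<le> Cz * B" for t
    proof -
      have "z t = w2 t + (2 * l * y t - l\<^sup>2 * x t)" by (simp add: w2_def)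
      then have "cmod (z t) \<le> cmod (w2 t) + (cmod (2 * l * y t) + cmod (l\<^sup>2 * x t))"
        by (auto intro!: norm_triangle_mono norm_triangle_ineq4)
      also have "\<dots> = cmod (w2 t) + (2 * cmod l * cmod (y t) + (cmod l)\<^sup>2 * cmod (x t))"
        by (simp add: norm_mult norm_power)
      also have "\<dots> \<le> C2 * B + (2 * cmod l * (Cy * B) + (cmod l)\<^sup>2 * (Cx * B))"
        by (intro add_mono mult_left_mono w2 x y) auto
      finally show ?thesis by (simp add: Cz_def algebra_simps)
    qed
    have "norm (s t) \<le> norm (fst (s t)) + (norm (fst (snd (s t))) + norm (snd (snd (s t))))"
      using norm_Pair_le[of "fst (s t)" "snd (s t)"]
        norm_Pair_le[of "fst (snd (s t))" "snd (snd (s t))"] by simp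
    also have "\<dots> \<le> Cx * B + (Cy * B + Cz * B)"
      using x[of t] y[of t] z[of t] unfolding x_def y_def z_def by (intro add_mono) simp_all
    finally show ?thesis by (simp add: algebra_simps)
  qed
  then show ?thesis using that[of "Cx + Cy + Cz"] nonneg by (metis add_nonneg_nonneg)
qed

text \<open>The triangular elimination is run backwards: solve for \<open>w2\<close>,
  \<open>w1\<close> and \<open>x\<close> in turn, then recover \<open>y\<close> and
  \<open>z\<close>. The result may be complex, but since \<open>a\<close>, \<open>k\<close> and
  \<open>g\<close> are real its real part solves the real system.\<close>

lemma moment_map_solution_exists:
  assumes "a > 0" and "k > 0" and "p > 0"
    and cont: "continuous_on UNIV g" and gper: "\<And>t. g (t + p) = g t"
  shows "\<exists>s. periodic_solution p (moment_map a k) g s"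
proof -
  obtain l r where a: "complex_of_real a = - (l + r)" and k: "complex_of_real k = l * r"
    and lr: "Re l < 0" "Re r < 0"
    using stable_quadratic_roots[OF assms(1,2)] by metis
  define g1 g2 g3 where "g1 t = complex_of_real (fst (g t))"
    and "g2 t = complex_of_real (fst (snd (g t)))" and "g3 t = complex_of_real (snd (snd (g t)))" for t
  have gc: "continuous_on UNIV g1" "continuous_on UNIV g2" "continuous_on UNIV g3"
    unfolding g1_def g2_def g3_def by (intro continuous_intros cont)+
  have gp: "g1 (t + p) = g1 t" "g2 (t + p) = g2 t" "g3 (t + p) = g3 t" for t
    by (simp_all add: g1_def g2_def g3_def gper)
  have "\<exists>w2. periodic_solution p ((*) (2 * r)) (\<lambda>t. g3 t - 2 * l * g2 t + l\<^sup>2 * g1 t) w2"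
    by (rule scalar_periodic_solution_exists)
      (use \<open>p > 0\<close> lr gp in \<open>auto intro!: continuous_intros gc\<close>)
  then obtain w2 where w2: "periodic_solution p ((*) (2 * r)) (\<lambda>t. g3 t - 2 * l * g2 t + l\<^sup>2 * g1 t) w2" ..
  have "\<exists>w1. periodic_solution p ((*) (of_real (- a))) (\<lambda>t. w2 t + (g2 t - l * g1 t)) w1"
    by (rule scalar_periodic_solution_exists)
      (use \<open>p > 0\<close> \<open>a > 0\<close> gp periodic_solutionD(1)[OF w2] in
        \<open>auto intro!: continuous_intros gc periodic_solution_continuous[OF w2]\<close>)
  then obtain w1 where w1: "periodic_solution p ((*) (of_real (- a))) (\<lambda>t. w2 t + (g2 t - l * g1 t)) w1" ..
  have "\<exists>x. periodic_solution p ((*) (2 * l)) (\<lambda>t. 2 * w1 t + g1 t) x"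
    by (rule scalar_periodic_solution_exists)
      (use \<open>p > 0\<close> lr gp periodic_solutionD(1)[OF w1] in
        \<open>auto intro!: continuous_intros gc periodic_solution_continuous[OF w1]\<close>)
  then obtain x where x: "periodic_solution p ((*) (2 * l)) (\<lambda>t. 2 * w1 t + g1 t) x" ..
  define y z where "y t = w1 t + l * x t" and "z t = w2 t + 2 * l * y t - l\<^sup>2 * x t" for t
  note d = periodic_solutionD(2)[OF x] periodic_solutionD(2)[OF w1] periodic_solutionD(2)[OF w2]
  note per = periodic_solutionD(1)[OF x] periodic_solutionD(1)[OF w1] periodic_solutionD(1)[OF w2]
  have dx: "(x has_vector_derivative (2 * y t + g1 t)) (at t)" for t
    by (rule has_vector_derivative_eq_rhs[OF d(1)]) (simp add: y_def algebra_simps)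
  have dy: "(y has_vector_derivative
      (z t - complex_of_real k * x t - complex_of_real a * y t + g2 t)) (at t)" for t
    unfolding y_def
    by (rule has_vector_derivative_eq_rhs,
        (rule has_vector_derivative_add has_vector_derivative_mult_right dx d)+,
        simp add: y_def z_def a k algebra_simps power2_eq_square)
  have dz: "(z has_vector_derivative
      (- 2 * complex_of_real k * y t - 2 * complex_of_real a * z t + g3 t)) (at t)" for t
    unfolding z_def
    by (rule has_vector_derivative_eq_rhs,
        (rule has_vector_derivative_add has_vector_derivative_diff
          has_vector_derivative_mult_right dx dy d)+,
        simp add: y_def z_def a k algebra_simps power2_eq_square)
  have re: "((\<lambda>t. Re (f t)) has_vector_derivative Re f') F"
    if "(f has_vector_derivative f') F" for f f' F
    using bounded_linear.has_vector_derivative[OF bounded_linear_Re that] .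
  define s where "s t = (Re (x t), Re (y t), Re (z t))" for t
  have "(s has_vector_derivative (moment_map a k (s t) + g t)) (at t)" for t
  proof -
    have "moment_map a k (s t) + g t = (Re (2 * y t + g1 t),
        Re (z t - complex_of_real k * x t - complex_of_real a * y t + g2 t),
        Re (- 2 * complex_of_real k * y t - 2 * complex_of_real a * z t + g3 t))"
      by (simp add: moment_map_def s_def g1_def g2_def g3_def plus_prod_def)
    then show ?thesis
      using re[OF dx] re[OF dy] re[OF dz]
      by (simp only: has_vector_derivative_Pair_iff) (simp add: s_def)
  qed
  moreover have "s (t + p) = s t" for t
    by (simp add: s_def y_def z_def per)
  ultimately show ?thesis by (auto simp: periodic_solution_def)
qed

subsection \<open>Lipschitz forcing\<close>

lemma periodic_solution_diff:
  assumes "linear L" and s: "periodic_solution p L g s" and s': "periodic_solution p L g' s'"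
  shows "periodic_solution p L (\<lambda>t. g t - g' t) (\<lambda>t. s t - s' t)"
  unfolding periodic_solution_def
proof (intro conjI allI)
  show "s (t + p) - s' (t + p) = s t - s' t" for t
    by (simp add: periodic_solutionD(1)[OF s] periodic_solutionD(1)[OF s'])
  show "((\<lambda>t. s t - s' t) has_vector_derivative (L (s t - s' t) + (g t - g' t))) (at t)" for t
    by (rule has_vector_derivative_eq_rhs,
        rule has_vector_derivative_diff[OF periodic_solutionD(2)[OF s] periodic_solutionD(2)[OF s']])
      (simp add: linear_diff[OF \<open>linear L\<close>])
qed

text \<open>Freezing the argument of \<open>P\<close> at a periodic function \<open>f\<close> and
  solving the linear equation defines a map of \<open>f\<close>. By the linear bound it contracts
  the sup norm by the factor \<open>C * n < 1\<close>, and its fixed points are the wanted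
  solutions.\<close>

lemma ex1_periodic_solution_of_Lipschitz_forcing:
  fixes L :: "'a \<Rightarrow> 'a :: banach" and P :: "real \<Rightarrow> 'a \<Rightarrow> 'a"
  assumes "p > 0" and "linear L"
    and exist: "\<And>g. continuous_on UNIV g \<Longrightarrow> (\<And>t. g (t + p) = g t) \<Longrightarrow> \<exists>s. periodic_solution p L g s"
    and bound: "\<And>g s B t. periodic_solution p L g s \<Longrightarrow> (\<And>t. norm (g t) \<le> B) \<Longrightarrow> norm (s t) \<le> C * B"
    and "C \<ge> 0" and "n \<ge> 0" and "C * n < 1"
    and P_lip: "\<And>t v w. norm (P t v - P t w) \<le> n * norm (v - w)"
    and P_per: "\<And>t v. P (t + p) v = P t v"
    and P_cont: "\<And>s. continuous_on UNIV s \<Longrightarrow> continuous_on UNIV (\<lambda>t. P t (s t))"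
  shows "\<exists>!s. periodic_solution p L (\<lambda>t. P t (s t)) s"
proof -
  have contraction: "norm (s t - s' t) \<le> C * n * d"
    if s: "periodic_solution p L (\<lambda>t. P t (f t)) s" and s': "periodic_solution p L (\<lambda>t. P t (f' t)) s'"
      and d: "\<And>t. norm (f t - f' t) \<le> d" for s s' f f' d t
  proof -
    have "norm (P t (f t) - P t (f' t)) \<le> n * d" for t
      using P_lip[of t "f t" "f' t"] mult_left_mono[OF d[of t] \<open>n \<ge> 0\<close>] by linarith
    then show ?thesis
      using bound[OF periodic_solution_diff[OF \<open>linear L\<close> s s'], of "n * d" t] by (simp add: mult.assoc)
  qed
  define Per where "Per = {f :: real \<Rightarrow>\<^sub>C 'a. \<forall>t. f (t + p) = f t}"
  \<comment> \<open>Any periodic solution will do as the chosen one; being continuous and periodic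
    it is bounded, so \<open>Bcontfun\<close> represents it faithfully.\<close>
  define \<Phi> where "\<Phi> f = Bcontfun (SOME s. periodic_solution p L (\<lambda>t. P t (apply_bcontfun f t)) s)" for f
  have \<Phi>: "periodic_solution p L (\<lambda>t. P t (f t)) (apply_bcontfun (\<Phi> f))" if "f \<in> Per" for f
  proof -
    define s where "s = (SOME s. periodic_solution p L (\<lambda>t. P t (f t)) s)"
    have "P (t + p) (f (t + p)) = P t (f t)" for t
      using that P_per[of t "f t"] by (simp add: Per_def)
    then have "\<exists>s. periodic_solution p L (\<lambda>t. P t (f t)) s"
      using exist P_cont continuous_on_apply_bcontfun by blast
    then have s: "periodic_solution p L (\<lambda>t. P t (f t)) s"
      unfolding s_def by (rule someI_ex)
    obtain t0 where "\<And>t. norm (s t) \<le> norm (s t0)"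
      using periodic_attains_norm_max[of p s] \<open>p > 0\<close> periodic_solutionD(1)[OF s]
        periodic_solution_continuous[OF s] by blast
    then have "s \<in> bcontfun"
      using periodic_solution_continuous[OF s] by (auto simp: bcontfun_def bounded_iff)
    then show ?thesis
      using s by (simp add: \<Phi>_def Bcontfun_inverse flip: s_def)
  qed
  have "closed Per"
    unfolding closed_sequential_limits
  proof (intro allI impI, elim conjE)
    fix F l assume F: "\<forall>i. F i \<in> Per" and lim: "F \<longlonglongrightarrow> l"
    have pt: "(\<lambda>i. F i t) \<longlonglongrightarrow> l t" for t
      using tendsto_uniform_limitI[OF tendsto_bcontfun_uniform_limit[OF lim]] by simp
    show "l \<in> Per"
      unfolding Per_def
    proof (intro CollectI allI)
      fix t
      show "l (t + p) = l t"
        using pt[of "t + p"] pt[of t] F by (auto simp: Per_def intro: LIMSEQ_unique)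
    qed
  qed
  moreover have "const_bcontfun 0 \<in> Per"
    by (simp add: Per_def)
  moreover have "\<Phi> ` Per \<subseteq> Per"
    using periodic_solutionD(1)[OF \<Phi>] by (auto simp: Per_def)
  moreover have "dist (\<Phi> f) (\<Phi> f') \<le> C * n * dist f f'" if "f \<in> Per" "f' \<in> Per" for f f'
    using contraction[OF \<Phi>[OF that(1)] \<Phi>[OF that(2)]] dist_bounded[of f _ f']
    by (intro dist_bound) (simp add: dist_norm)
  ultimately obtain f where f: "f \<in> Per" "\<Phi> f = f"
    using Banach_fix[of Per "C * n" \<Phi>] \<open>C \<ge> 0\<close> \<open>n \<ge> 0\<close> \<open>C * n < 1\<close>
    by (auto simp: complete_eq_closed)
  \<comment> \<open>Two solutions are compared at the time \<open>t0\<close> where they differ most;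
    contraction with factor below 1 makes that difference vanish.\<close>
  have "s = s'"
    if s: "periodic_solution p L (\<lambda>t. P t (s t)) s" and s': "periodic_solution p L (\<lambda>t. P t (s' t)) s'"
    for s s'
  proof -
    obtain t0 where t0: "\<And>t. norm (s t - s' t) \<le> norm (s t0 - s' t0)"
      using periodic_attains_norm_max[of p "\<lambda>t. s t - s' t"] \<open>p > 0\<close>
        periodic_solutionD(1)[OF periodic_solution_diff[OF \<open>linear L\<close> s s']]
        periodic_solution_continuous[OF periodic_solution_diff[OF \<open>linear L\<close> s s']] by blast
    have "norm (s t0 - s' t0) \<le> C * n * norm (s t0 - s' t0)"
      by (rule contraction[OF s s' t0])
    then have "(1 - C * n) * norm (s t0 - s' t0) \<le> 0"
      by (simp add: left_diff_distrib)
    then have "norm (s t0 - s' t0) \<le> 0"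
      using \<open>C * n < 1\<close> by (simp add: mult_le_0_iff)
    then have "norm (s t - s' t) \<le> 0" for t
      using t0[of t] by linarith
    then show ?thesis by auto
  qed
  then show ?thesis using \<Phi>[OF f(1)] f(2) by metis
qed

subsection \<open>Covariance matrices and their moments\<close>

definition sym_mat :: "real \<times> real \<times> real \<Rightarrow> real ^ 2 ^ 2" where
  "sym_mat = (\<lambda>(x, y, z). mat2 x y y z)"

lemma mat2_nth [simp]:
  "mat2 a b c d $ 1 $ 1 = a" "mat2 a b c d $ 1 $ 2 = b"
  "mat2 a b c d $ 2 $ 1 = c" "mat2 a b c d $ 2 $ 2 = d"
  by (simp_all add: mat2_def)

lemma mat2_eq_iff: "A = mat2 a b c d \<longleftrightarrow> A $ 1 $ 1 = a \<and> A $ 1 $ 2 = b \<and> A $ 2 $ 1 = c \<and> A $ 2 $ 2 = d"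
  by (auto simp: vec_eq_iff forall_2)

lemma matrix_mult_2_nth:
  fixes A B :: "real ^ 2 ^ 2"
  shows "(A ** B) $ i $ j = A $ i $ 1 * B $ 1 $ j + A $ i $ 2 * B $ 2 $ j"
  by (simp add: matrix_matrix_mult_def sum_2)

lemma transpose_nth: "transpose A $ i $ j = A $ j $ i"
  by (simp add: transpose_def)

lemma sym_mat_nth [simp]:
  "sym_mat s $ 1 $ 1 = fst s" "sym_mat s $ 1 $ 2 = fst (snd s)"
  "sym_mat s $ 2 $ 1 = fst (snd s)" "sym_mat s $ 2 $ 2 = snd (snd s)"
  by (simp_all add: sym_mat_def case_prod_beta)

lemma bounded_linear_sym_mat: "bounded_linear sym_mat"
  unfolding linear_conv_bounded_linear[symmetric]
  by (rule linearI) (auto simp: vec_eq_iff forall_2)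

lemma bounded_linear_mat_entries:
  "bounded_linear (\<lambda>S :: real ^ 2 ^ 2. (S $ 1 $ 1, S $ 1 $ 2, S $ 2 $ 2))"
  unfolding linear_conv_bounded_linear[symmetric]
  by (rule linearI) auto

text \<open>The deviation of the gain from a reference value \<open>q0\<close> is moved into the
  forcing, so all three Lyapunov equations share one constant-coefficient linear part. The entries
  \<open>e\<close> and \<open>h\<close> leave room for the control term of the first-order equation
  and for the noise.\<close>

lemma periodic_lyapunov_solution_iff_moments:
  "periodic_lyapunov_solution p (\<lambda>t. drift_matrix m \<gamma> (q t)) (\<lambda>t. mat2 0 (e t) (e t) (h t)) S \<longleftrightarrow>
     (\<exists>s. S = (\<lambda>t. sym_mat (s t)) \<and>
        periodic_solution p (moment_map (\<gamma> / m) (q0 / m))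
          (\<lambda>t. (0, e t - (q t - q0) / m * fst (s t), h t - 2 * ((q t - q0) / m) * fst (snd (s t)))) s)"
    (is "?lhs \<longleftrightarrow> ?rhs")
proof
  assume S: ?lhs
  define s where "s t = (S t $ 1 $ 1, S t $ 1 $ 2, S t $ 2 $ 2)" for t
  have sym: "S t $ 2 $ 1 = S t $ 1 $ 2" for t
  proof -
    have "transpose (S t) = S t"
      using S unfolding periodic_lyapunov_solution_def by blast
    then show ?thesis
      by (metis transpose_nth)
  qed
  then have S_eq: "S = (\<lambda>t. sym_mat (s t))"
    by (simp add: fun_eq_iff vec_eq_iff forall_2 s_def)
  have "(s has_vector_derivative (moment_map (\<gamma> / m) (q0 / m) (s t)
      + (0, e t - (q t - q0) / m * fst (s t), h t - 2 * ((q t - q0) / m) * fst (snd (s t))))) (at t)" for t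
  proof -
    have "(S has_vector_derivative (drift_matrix m \<gamma> (q t) ** S t + S t ** transpose (drift_matrix m \<gamma> (q t))
        + mat2 0 (e t) (e t) (h t))) (at t)"
      using S unfolding periodic_lyapunov_solution_def by blast
    from bounded_linear.has_vector_derivative[OF bounded_linear_mat_entries this]
    show ?thesis
      unfolding s_def[abs_def, symmetric]
      by (rule has_vector_derivative_eq_rhs)
        (simp add: sym s_def moment_map_def matrix_mult_2_nth transpose_def drift_matrix_def
          diff_divide_distrib left_diff_distrib algebra_simps)
  qed
  moreover have "s (t + p) = s t" for t
    using S by (simp add: periodic_lyapunov_solution_def s_def)
  ultimately show ?rhs
    using S_eq by (auto simp: periodic_solution_def)
next
  assume ?rhs
  then obtain s where S_eq: "S = (\<lambda>t. sym_mat (s t))"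
    and s: "periodic_solution p (moment_map (\<gamma> / m) (q0 / m))
        (\<lambda>t. (0, e t - (q t - q0) / m * fst (s t), h t - 2 * ((q t - q0) / m) * fst (snd (s t)))) s"
    by blast
  have "((\<lambda>t. sym_mat (s t)) has_vector_derivative (drift_matrix m \<gamma> (q t) ** S t
      + S t ** transpose (drift_matrix m \<gamma> (q t)) + mat2 0 (e t) (e t) (h t))) (at t)" for t
    by (rule has_vector_derivative_eq_rhs,
        rule bounded_linear.has_vector_derivative[OF bounded_linear_sym_mat periodic_solutionD(2)[OF s]])
      (simp add: S_eq vec_eq_iff forall_2 moment_map_def matrix_mult_2_nth transpose_def
        drift_matrix_def case_prod_beta diff_divide_distrib left_diff_distrib algebra_simps)
  then show ?lhs
    using periodic_solutionD(1)[OF s]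
    by (simp add: periodic_lyapunov_solution_def S_eq vec_eq_iff forall_2 transpose_def)
qed

text \<open>Since \<open>R\<close> has exactly one solution, \<open>Q S\<close> amounts to
  \<open>S\<close> being the matrix function of that solution. This transfers unique existence and
  identifies the definite descriptions behind the covariances.\<close>

lemma ex1_and_the_of_moments:
  fixes Q :: "(real \<Rightarrow> real ^ 2 ^ 2) \<Rightarrow> bool" and R :: "(real \<Rightarrow> real \<times> real \<times> real) \<Rightarrow> bool"
  assumes iff: "\<And>S. Q S \<longleftrightarrow> (\<exists>s. S = (\<lambda>t. sym_mat (s t)) \<and> R s)" and ex1: "\<exists>!s. R s"
  shows "\<exists>!S. Q S" and "R s \<Longrightarrow> (THE S. Q S) = (\<lambda>t. sym_mat (s t))"
proof -
  define s0 where "s0 = (THE s. R s)"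
  have s0: "R s0"
    unfolding s0_def by (rule theI'[OF ex1])
  have uniq: "s = s0" if "R s" for s
    unfolding s0_def by (rule the1_equality[where P = R, OF ex1 that, symmetric])
  have Q: "Q S \<longleftrightarrow> S = (\<lambda>t. sym_mat (s0 t))" for S
    unfolding iff by (metis s0 uniq)
  show "\<exists>!S. Q S"
    unfolding Q by simp
  show "(THE S. Q S) = (\<lambda>t. sym_mat (s t))" if "R s"
    unfolding Q uniq[OF that] by simp
qed

subsection \<open>The Langevin cycle\<close>

locale langevin_cycle =
  fixes m \<gamma> kB \<omega> q0 T0 T1 :: real
  assumes pos: "m > 0" "\<gamma> > 0" "kB > 0" "\<omega> > 0" "q0 > 0" "T0 > 0"
begin

definition a where "a = \<gamma> / m"
definition k where "k = q0 / m"
definition p where "p = 2 * pi / \<omega>"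
text \<open>The constant \<open>c\<close> is the equilibrium position variance divided by
  \<open>m\<close>, the strength with which the control enters the first-order equations;
  \<open>\<kappa>\<close> is the equilibrium velocity variance at temperature
  \<open>T1\<close>.\<close>

definition c where "c = T0 * kB / (q0 * m)"
definition \<kappa> where "\<kappa> = kB * T1 / m"

lemma pos': "a > 0" "k > 0" "p > 0" "c > 0"
  using pos by (simp_all add: a_def k_def p_def c_def)

text \<open>The second moments of the Gibbs distribution at temperature \<open>T0\<close>, as given
  by equipartition.\<close>

definition equilibrium where "equilibrium = (T0 * kB / q0, 0 :: real, T0 * kB / m)"

definition noise :: "real \<Rightarrow> real \<times> real \<times> real" where
  "noise T = (0, 0, T * (2 * \<gamma> * kB / m\<^sup>2))"

text \<open>The effect of raising the drift entry \<open>q / m\<close> by \<open>w\<close>.\<close>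

definition gain_map :: "real \<Rightarrow> real \<times> real \<times> real \<Rightarrow> real \<times> real \<times> real" where
  "gain_map w = (\<lambda>(x, y, z). (0, - w * x, - 2 * w * y))"

text \<open>The factor 3 is 1 + 2, from the two nonzero components. As the map is linear in the
  state, this is also the Lipschitz estimate for the perturbed equation.\<close>

lemma norm_gain_map: "norm (gain_map w v) \<le> 3 * \<bar>w\<bar> * norm v"
proof -
  have "norm (gain_map w v) \<le> \<bar>w\<bar> * norm (fst v) + 2 * \<bar>w\<bar> * norm (fst (snd v))"
    using norm_Pair_le[of 0 "(- w * fst v, - 2 * w * fst (snd v))"]
      norm_Pair_le[of "- w * fst v" "- 2 * w * fst (snd v)"]
    by (simp add: gain_map_def case_prod_beta abs_mult)
  moreover have "norm (fst v) \<le> norm v" and "norm (fst (snd v)) \<le> norm v"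
    using norm_fst_le[of "fst v" "snd v"] norm_snd_le[of "snd v" "fst v"]
      norm_fst_le[of "fst (snd v)" "snd (snd v)"] by simp_all
  ultimately show ?thesis
    using mult_left_mono[of "norm (fst v)" "norm v" "\<bar>w\<bar>"]
      mult_left_mono[of "norm (fst (snd v))" "norm v" "\<bar>w\<bar>"] by simp
qed

lemma gain_map_diff: "gain_map w v - gain_map w v' = gain_map w (v - v')"
  by (simp add: gain_map_def case_prod_beta algebra_simps)

lemma gain_map_scale: "gain_map (e * w) v = e *\<^sub>R gain_map w v"
  by (simp add: gain_map_def case_prod_beta)

lemma continuous_on_gain_map:
  assumes "continuous_on A w" and "continuous_on A s"
  shows "continuous_on A (\<lambda>t. gain_map (w t) (s t))"
  unfolding gain_map_def case_prod_beta by (intro continuous_intros assms)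

lemma cos_periodic: "cos (\<omega> * (t + p)) = cos (\<omega> * t)" "sin (\<omega> * (t + p)) = sin (\<omega> * t)"
proof -
  have "\<omega> * (t + p) = \<omega> * t + 2 * pi"
    using pos by (simp add: p_def distrib_left)
  then show "cos (\<omega> * (t + p)) = cos (\<omega> * t)" "sin (\<omega> * (t + p)) = sin (\<omega> * t)" by simp_all
qed

abbreviation solves where "solves \<equiv> periodic_solution p (moment_map a k)"

lemma solves_bound:
  obtains C where "C \<ge> 0" and
    "\<And>g s B t. solves g s \<Longrightarrow> (\<And>t. norm (g t) \<le> B) \<Longrightarrow> norm (s t) \<le> C * B"
  using moment_map_solution_bound[OF pos'(1,2,3)] by metis

lemma ex1_solves:
  assumes "continuous_on UNIV g" and "\<And>t. g (t + p) = g t"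
  shows "\<exists>!s. solves g s"
proof -
  obtain C where C: "C \<ge> 0" "\<And>g s B t. solves g s \<Longrightarrow> (\<And>t. norm (g t) \<le> B) \<Longrightarrow> norm (s t) \<le> C * B"
    using solves_bound by metis
  show ?thesis
    \<comment> \<open>Forcing that ignores the state has Lipschitz constant 0.\<close>
    by (rule ex1_periodic_solution_of_Lipschitz_forcing[where C = C and n = 0 and P = "\<lambda>t v. g t"])
      (use assms C pos' in \<open>auto simp: linear_moment_map intro: moment_map_solution_exists\<close>)
qed

lemma solves_equilibrium: "solves (\<lambda>t. noise T0) (\<lambda>t. equilibrium)"
proof -
  have "moment_map a k equilibrium + noise T0 = 0"
    using pos by (simp add: moment_map_def equilibrium_def noise_def a_def k_def
        power2_eq_square zero_prod_def)
  then show ?thesis by (simp add: periodic_solution_def)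
qed

section \<open>The Lyapunov equations of the cycle in moment form\<close>

lemma is_sigma0_iff:
  "is_sigma0 m \<gamma> kB \<omega> q0 T0 S \<longleftrightarrow>
     (\<exists>s. S = (\<lambda>t. sym_mat (s t)) \<and> solves (\<lambda>t. noise T0) s)"
proof -
  have "T0 *\<^sub>R noise_matrix m \<gamma> kB = mat2 0 0 0 (T0 * (2 * \<gamma> * kB / m\<^sup>2))"
    by (simp add: mat2_eq_iff noise_matrix_def)
  then show ?thesis
    using periodic_lyapunov_solution_iff_moments[of p m \<gamma> "\<lambda>t. q0" "\<lambda>t. 0"
        "\<lambda>t. T0 * (2 * \<gamma> * kB / m\<^sup>2)" S q0]
    by (simp add: is_sigma0_def noise_def a_def k_def p_def)
qed

lemma ex1_sigma0: "\<exists>!S. is_sigma0 m \<gamma> kB \<omega> q0 T0 S"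
  and sigma0_eq: "sigma0 m \<gamma> kB \<omega> q0 T0 = (\<lambda>t. sym_mat equilibrium)"
proof -
  have ex1: "\<exists>!s. solves (\<lambda>t. noise T0) s"
    by (rule ex1_solves) auto
  show "\<exists>!S. is_sigma0 m \<gamma> kB \<omega> q0 T0 S"
    by (rule ex1_and_the_of_moments(1)[OF is_sigma0_iff ex1])
  show "sigma0 m \<gamma> kB \<omega> q0 T0 = (\<lambda>t. sym_mat equilibrium)"
    unfolding sigma0_def
    by (rule ex1_and_the_of_moments(2)[OF is_sigma0_iff ex1 solves_equilibrium])
qed

text \<open>The coefficient of \<open>\<epsilon>\<close> in the full forcing when the state is held
  at \<open>equilibrium\<close>.\<close>

definition first_order_forcing where
  "first_order_forcing u t = noise (T1 * cos (\<omega> * t)) + gain_map (u t / m) equilibrium"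

lemma first_order_forcing_eq: "first_order_forcing u t = (0, - c * u t, 2 * a * \<kappa> * cos (\<omega> * t))"
  by (simp add: first_order_forcing_def noise_def gain_map_def equilibrium_def c_def a_def \<kappa>_def
      power2_eq_square ac_simps)

lemma is_sigma1_iff:
  "is_sigma1 m \<gamma> kB \<omega> q0 T0 T1 u S \<longleftrightarrow>
     (\<exists>s. S = (\<lambda>t. sym_mat (s t)) \<and> solves (first_order_forcing u) s)"
proof -
  have "gain_matrix m (u t) ** sigma0 m \<gamma> kB \<omega> q0 T0 t
          + sigma0 m \<gamma> kB \<omega> q0 T0 t ** transpose (gain_matrix m (u t))
          + (T1 * cos (\<omega> * t)) *\<^sub>R noise_matrix m \<gamma> kB
      = mat2 0 (- c * u t) (- c * u t) (2 * a * \<kappa> * cos (\<omega> * t))" for t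
    by (simp add: mat2_eq_iff noise_matrix_def gain_matrix_def matrix_mult_2_nth transpose_nth
        sigma0_eq equilibrium_def c_def a_def \<kappa>_def power2_eq_square ac_simps)
  then show ?thesis
    using periodic_lyapunov_solution_iff_moments[of p m \<gamma> "\<lambda>t. q0" "\<lambda>t. - c * u t"
        "\<lambda>t. 2 * a * \<kappa> * cos (\<omega> * t)" S q0]
    by (simp add: is_sigma1_def first_order_forcing_eq[abs_def] flip: a_def k_def p_def)
qed

lemma ex1_first_order:
  assumes "continuous_on UNIV u" and "\<And>t. u (t + p) = u t"
  shows "\<exists>!s. solves (first_order_forcing u) s"
  by (rule ex1_solves)
    (auto simp: first_order_forcing_eq[abs_def] assms cos_periodic intro!: continuous_intros assms)

definition forcing where
  "forcing \<epsilon> u t v = noise (T0 + \<epsilon> * T1 * cos (\<omega> * t)) + gain_map (\<epsilon> * u t / m) v"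

lemma is_cyclic_covariance_iff:
  "is_cyclic_covariance m \<gamma> kB \<omega> q0 T0 T1 \<epsilon> u S \<longleftrightarrow>
     (\<exists>s. S = (\<lambda>t. sym_mat (s t)) \<and> solves (\<lambda>t. forcing \<epsilon> u t (s t)) s)"
proof -
  have "(T0 + \<epsilon> * T1 * cos (\<omega> * t)) *\<^sub>R noise_matrix m \<gamma> kB
      = mat2 0 0 0 ((T0 + \<epsilon> * T1 * cos (\<omega> * t)) * (2 * \<gamma> * kB / m\<^sup>2))" for t
    by (simp add: mat2_eq_iff noise_matrix_def)
  then show ?thesis
    using periodic_lyapunov_solution_iff_moments[of p m \<gamma> "\<lambda>t. q0 + \<epsilon> * u t" "\<lambda>t. 0"
        "\<lambda>t. (T0 + \<epsilon> * T1 * cos (\<omega> * t)) * (2 * \<gamma> * kB / m\<^sup>2)" S q0]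
    by (simp add: is_cyclic_covariance_def forcing_def noise_def gain_map_def case_prod_beta a_def k_def p_def)
qed

lemma admissible_control_continuous:
  assumes "admissible_control \<omega> u"
  shows "continuous_on UNIV u"
  using assms periodic_continuous_on_UNIV[of p u] pos'(3)
  by (auto simp: admissible_control_def p_def intro: differentiable_imp_continuous_on)

lemma admissible_control_has_derivative:
  assumes "admissible_control \<omega> u" and "t \<in> {0..p}"
  shows "(u has_vector_derivative control_deriv \<omega> u t) (at t within {0..p})"
  using assms by (simp add: admissible_control_def control_deriv_def p_def differentiable_on_def
      vector_derivative_works)

lemma ex1_sigma1:
  assumes "admissible_control \<omega> u"
  shows "\<exists>!S. is_sigma1 m \<gamma> kB \<omega> q0 T0 T1 u S"
  using ex1_and_the_of_moments(1)[OF is_sigma1_iff ex1_first_order]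
    admissible_control_continuous[OF assms] assms by (simp add: admissible_control_def p_def)

lemma sigma1_eq:
  assumes "admissible_control \<omega> u" and "solves (first_order_forcing u) s"
  shows "sigma1 m \<gamma> kB \<omega> q0 T0 T1 u = (\<lambda>t. sym_mat (s t))"
  unfolding sigma1_def
  by (rule ex1_and_the_of_moments(2)[OF is_sigma1_iff ex1_first_order assms(2)])
    (use admissible_control_continuous[OF assms(1)] assms(1) in \<open>auto simp: admissible_control_def p_def\<close>)

subsection \<open>The optimal control\<close>

lemma solves_first_orderD:
  assumes "solves (first_order_forcing u) s"
  defines "x \<equiv> \<lambda>t. fst (s t)" and "y \<equiv> \<lambda>t. fst (snd (s t))" and "z \<equiv> \<lambda>t. snd (snd (s t))"
  shows "(x has_vector_derivative (2 * y t)) (at t within A)"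
    and "(y has_vector_derivative (z t - k * x t - a * y t - c * u t)) (at t within A)"
    and "(z has_vector_derivative (- 2 * k * y t - 2 * a * z t + 2 * a * \<kappa> * cos (\<omega> * t))) (at t within A)"
proof -
  have "(s has_vector_derivative (2 * y t, (z t - k * x t - a * y t - c * u t),
      (- 2 * k * y t - 2 * a * z t + 2 * a * \<kappa> * cos (\<omega> * t)))) (at t within A)"
    using has_vector_derivative_at_within[OF periodic_solutionD(2)[OF assms(1)]]
    by (simp add: moment_map_def first_order_forcing_eq case_prod_beta x_def y_def z_def)
  then show "(x has_vector_derivative (2 * y t)) (at t within A)"
    and "(y has_vector_derivative (z t - k * x t - a * y t - c * u t)) (at t within A)"
    and "(z has_vector_derivative (- 2 * k * y t - 2 * a * z t + 2 * a * \<kappa> * cos (\<omega> * t))) (at t within A)"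
    by (simp_all add: has_vector_derivative_Pair_iff x_def y_def z_def)
qed

text \<open>
  The work integrand differs from that of the reference control by an exact derivative minus
  \<open>(2 / c) (a (y - y\<^sub>0)\<^sup>2 + (a / k) (z - z\<^sub>0)\<^sup>2)\<close>; the stationarity hypothesis removes
  the terms linear in \<open>z - z\<^sub>0\<close>.
\<close>

lemma work_le_stationary_work:
  assumes u: "\<And>t. t \<in> {0..p} \<Longrightarrow> (u has_vector_derivative u' t) (at t within {0..p})"
      "u p = u 0" "continuous_on {0..p} u'"
    and u0: "\<And>t. t \<in> {0..p} \<Longrightarrow> (u0 has_vector_derivative u0' t) (at t within {0..p})"
      "u0 p = u0 0" "continuous_on {0..p} u0'"
    and s: "solves (first_order_forcing u) s" and s0: "solves (first_order_forcing u0) s0"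
    and stationary: "\<And>t. 2 * a\<^sup>2 * fst (snd (s0 t))
        - a * (snd (snd (s0 t)) - k * fst (s0 t) - a * fst (snd (s0 t)) - c * u0 t)
        - 2 * a * snd (snd (s0 t)) + a * \<kappa> * cos (\<omega> * t) = 0"
  shows "integral {0..p} (\<lambda>t. u0' t * fst (s0 t)) \<le> integral {0..p} (\<lambda>t. u' t * fst (s t))"
proof -
  define x y z where "x t = fst (s t)" and "y t = fst (snd (s t))" and "z t = snd (snd (s t))" for t
  define x0 y0 z0 where "x0 t = fst (s0 t)" and "y0 t = fst (snd (s0 t))" and "z0 t = snd (snd (s0 t))" for t
  define f where "f t = 2 * a * \<kappa> * cos (\<omega> * t)" for t
  define y0' where "y0' t = z0 t - k * x0 t - a * y0 t - c * u0 t" for t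
  have d: "(x has_vector_derivative (2 * y t)) (at t within A)"
      "(y has_vector_derivative (z t - k * x t - a * y t - c * u t)) (at t within A)"
      "(z has_vector_derivative (- 2 * k * y t - 2 * a * z t + f t)) (at t within A)" for t A
    using solves_first_orderD[OF s] by (simp_all add: x_def[abs_def] y_def[abs_def] z_def[abs_def] f_def)
  have d0: "(x0 has_vector_derivative (2 * y0 t)) (at t within A)"
      "(y0 has_vector_derivative y0' t) (at t within A)"
      "(z0 has_vector_derivative (- 2 * k * y0 t - 2 * a * z0 t + f t)) (at t within A)" for t A
    using solves_first_orderD[OF s0]
    by (simp_all add: x0_def[abs_def] y0_def[abs_def] z0_def[abs_def] f_def y0'_def)
  \<comment> \<open>Stationarity expresses the noise forcing through the reference solution; this is
    what closes the square in \<open>z - z0\<close> below.\<close>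
  have f: "f t = 4 * a * z0 t + 2 * a * y0' t - 4 * a\<^sup>2 * y0 t" for t
    using stationary[of t] unfolding f_def y0'_def x0_def y0_def z0_def by (simp add: algebra_simps)
  \<comment> \<open>The weights \<open>k / 4\<close>, \<open>1 / 2\<close>,
    \<open>1 / (4 * k)\<close> cancel the products \<open>x y\<close> and \<open>y z\<close> in the
    derivative, and the factor \<open>2 / c\<close> cancels \<open>u y\<close> against the
    derivative of \<open>u x\<close>. The last summand supplies the term in
    \<open>y0 * (y - y0)\<close> that completes the square in \<open>y\<close>; with the formula for
    \<open>f\<close> the remaining terms in \<open>z\<close> form a square too.\<close>
  define \<Phi> where "\<Phi> t = - (u t * x t) - 2 / c * (k / 4 * (x t * x t) + 1 / 2 * (y t * y t) + 1 / (4 * k) * (z t * z t))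
      + u0 t * x0 t + 2 / c * (k / 4 * (x0 t * x0 t) + 1 / 2 * (y0 t * y0 t) + 1 / (4 * k) * (z0 t * z0 t))
      + 2 * a / (c * k) * (y0 t * (z t - z0 t))" for t
  have d\<Phi>: "(\<Phi> has_vector_derivative (u0' t * x0 t - u' t * x t
      + 2 / c * (a * (y t - y0 t)\<^sup>2 + a / k * (z t - z0 t)\<^sup>2))) (at t within {0..p})"
    if "t \<in> {0..p}" for t
    unfolding \<Phi>_def
    by (rule has_vector_derivative_eq_rhs,
        (rule has_vector_derivative_add has_vector_derivative_diff has_vector_derivative_minus
          has_vector_derivative_mult_right has_vector_derivative_mult d d0 u(1)[OF that] u0(1)[OF that])+,
        use pos' in \<open>simp add: f y0'_def field_simps power2_eq_square\<close>)
  have "x p = x 0" "y p = y 0" "z p = z 0" "x0 p = x0 0" "y0 p = y0 0" "z0 p = z0 0"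
    using periodic_solutionD(1)[OF s, of 0] periodic_solutionD(1)[OF s0, of 0]
    by (simp_all add: x_def y_def z_def x0_def y0_def z0_def)
  then have "\<Phi> p = \<Phi> 0" by (simp add: \<Phi>_def u u0)
  then have \<Phi>_int: "((\<lambda>t. u0' t * x0 t - u' t * x t
      + 2 / c * (a * (y t - y0 t)\<^sup>2 + a / k * (z t - z0 t)\<^sup>2)) has_integral 0) {0..p}"
    using fundamental_theorem_of_calculus[OF _ d\<Phi>] pos' by simp
  have cont: "continuous_on {0..p} (\<lambda>t. u' t * x t)" "continuous_on {0..p} (\<lambda>t. u0' t * x0 t)"
    using u(3) u0(3) periodic_solution_continuous[OF s] periodic_solution_continuous[OF s0]
    unfolding x_def x0_def by (intro continuous_intros; simp)+
  then have "((\<lambda>t. u0' t * x0 t - u' t * x t) has_integral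
      (integral {0..p} (\<lambda>t. u0' t * x0 t) - integral {0..p} (\<lambda>t. u' t * x t))) {0..p}"
    by (intro has_integral_diff integrable_integral integrable_continuous_interval)
  \<comment> \<open>Adding the nonnegative squares raises the integrand to one with integral
    0.\<close>
  from has_integral_le[OF this \<Phi>_int] show ?thesis
    using pos' by (simp add: x_def x0_def)
qed

text \<open>The cosine law expanded in \<open>cos (\<omega> * t)\<close> and
  \<open>sin (\<omega> * t)\<close>: the two inner coefficients are \<open>\<beta>\<close> and
  \<open>- \<alpha>\<close> divided by \<open>m\<^sup>2 * \<omega>\<close>. This form avoids the
  phase in the computations.\<close>

definition optimal_control where
  "optimal_control t = \<kappa> / (c * (\<omega>\<^sup>2 + 4 * k + 4 * a\<^sup>2)) *
     ((2 * a\<^sup>2 + 4 * k - \<omega>\<^sup>2) * cos (\<omega> * t) + (3 * a * \<omega> - 4 * a * k / \<omega>) * sin (\<omega> * t))"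

text \<open>
  Adding the third moment equation to the stationarity condition of \<open>work_le_stationary_work\<close>
  determines the second component; the others and \<open>optimal_control\<close> follow by elimination.
\<close>

definition optimal_response where
  "optimal_response t = (\<kappa> / (\<omega>\<^sup>2 + 4 * k + 4 * a\<^sup>2)) *\<^sub>R
     (4 * a / \<omega> * sin (\<omega> * t) - 2 * cos (\<omega> * t),
      2 * a * cos (\<omega> * t) + \<omega> * sin (\<omega> * t),
      (4 * a\<^sup>2 + 2 * k) * cos (\<omega> * t) + 2 * a * \<omega> * sin (\<omega> * t))"

lemma denominator_pos: "\<omega>\<^sup>2 + 4 * k + 4 * a\<^sup>2 > 0"
  using pos pos' by (simp add: add_pos_pos)

lemma has_vector_derivative_cos_sin:
  "((\<lambda>t. cos (\<omega> * t)) has_vector_derivative (- \<omega> * sin (\<omega> * t))) (at t within A)"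
  "((\<lambda>t. sin (\<omega> * t)) has_vector_derivative (\<omega> * cos (\<omega> * t))) (at t within A)"
  unfolding has_real_derivative_iff_has_vector_derivative[symmetric]
  by (auto intro!: derivative_eq_intros)

lemma solves_optimal_response: "solves (first_order_forcing optimal_control) optimal_response"
  unfolding periodic_solution_def
proof (intro conjI allI)
  fix t
  show "optimal_response (t + p) = optimal_response t"
    by (simp add: optimal_response_def cos_periodic)
  \<comment> \<open>The name \<open>E\<close> stays opaque while denominators are cleared; its value
    enters only in the final polynomial identity.\<close>
  define E where "E = \<omega>\<^sup>2 + 4 * k + 4 * a\<^sup>2"
  have E: "E > 0" unfolding E_def by (rule denominator_pos)
  have "(optimal_response has_vector_derivative
      ((\<kappa> / E) * (4 * a / \<omega> * (\<omega> * cos (\<omega> * t)) - 2 * (- \<omega> * sin (\<omega> * t))),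
       (\<kappa> / E) * (2 * a * (- \<omega> * sin (\<omega> * t)) + \<omega> * (\<omega> * cos (\<omega> * t))),
       (\<kappa> / E) * ((4 * a\<^sup>2 + 2 * k) * (- \<omega> * sin (\<omega> * t)) + 2 * a * \<omega> * (\<omega> * cos (\<omega> * t))))) (at t)"
    unfolding has_vector_derivative_Pair_iff optimal_response_def E_def[symmetric]
      scaleR_Pair fst_conv snd_conv real_scaleR_def
    by (intro conjI has_vector_derivative_add has_vector_derivative_diff
        has_vector_derivative_mult_right has_vector_derivative_cos_sin)
  moreover have "optimal_control t = \<kappa> / (c * E) *
     ((2 * a\<^sup>2 + 4 * k - \<omega>\<^sup>2) * cos (\<omega> * t) + (3 * a * \<omega> - 4 * a * k / \<omega>) * sin (\<omega> * t))"
    by (simp add: optimal_control_def E_def)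
  moreover have "optimal_response t = (\<kappa> / E * (4 * a / \<omega> * sin (\<omega> * t) - 2 * cos (\<omega> * t)),
      \<kappa> / E * (2 * a * cos (\<omega> * t) + \<omega> * sin (\<omega> * t)),
      \<kappa> / E * ((4 * a\<^sup>2 + 2 * k) * cos (\<omega> * t) + 2 * a * \<omega> * sin (\<omega> * t)))"
    by (simp add: optimal_response_def E_def)
  ultimately show "(optimal_response has_vector_derivative
      (moment_map a k (optimal_response t) + first_order_forcing optimal_control t)) (at t)"
    using pos pos' E
    by (elim has_vector_derivative_eq_rhs)
      (simp add: moment_map_def first_order_forcing_eq, simp add: field_simps,
        simp add: E_def algebra_simps power2_eq_square)
qed

lemma optimal_response_stationary:
  "2 * a\<^sup>2 * fst (snd (optimal_response t))
     - a * (snd (snd (optimal_response t)) - k * fst (optimal_response t)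
         - a * fst (snd (optimal_response t)) - c * optimal_control t)
     - 2 * a * snd (snd (optimal_response t)) + a * \<kappa> * cos (\<omega> * t) = 0"
proof -
  \<comment> \<open>The terms in \<open>W\<close> cancel between \<open>k x\<close> and the control,
    and every remaining term carries the factor \<open>R\<close>, so the claim is a polynomial
    identity without divisions.\<close>
  define R W where "R = \<kappa> / (\<omega>\<^sup>2 + 4 * k + 4 * a\<^sup>2)" and "W = 4 * a / \<omega>"
  have \<kappa>: "\<kappa> = R * (\<omega>\<^sup>2 + 4 * k + 4 * a\<^sup>2)"
    using denominator_pos by (simp add: R_def)
  have u: "c * optimal_control t =
      R * ((2 * a\<^sup>2 + 4 * k - \<omega>\<^sup>2) * cos (\<omega> * t) + (3 * a * \<omega> - W * k) * sin (\<omega> * t))"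
    using pos' by (simp add: optimal_control_def R_def W_def)
  have s: "optimal_response t = (R * (W * sin (\<omega> * t) - 2 * cos (\<omega> * t)),
      R * (2 * a * cos (\<omega> * t) + \<omega> * sin (\<omega> * t)),
      R * ((4 * a\<^sup>2 + 2 * k) * cos (\<omega> * t) + 2 * a * \<omega> * sin (\<omega> * t)))"
    by (simp add: optimal_response_def R_def W_def)
  show ?thesis
    unfolding u s fst_conv snd_conv \<kappa> by (simp add: algebra_simps power2_eq_square)
qed

section \<open>Admissibility of the explicit sinusoid\<close>

definition optimal_control' where
  "optimal_control' t = \<kappa> / (c * (\<omega>\<^sup>2 + 4 * k + 4 * a\<^sup>2)) *
     ((2 * a\<^sup>2 + 4 * k - \<omega>\<^sup>2) * (- \<omega> * sin (\<omega> * t)) + (3 * a * \<omega> - 4 * a * k / \<omega>) * (\<omega> * cos (\<omega> * t)))"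

lemma optimal_control_has_derivative:
  "(optimal_control has_vector_derivative optimal_control' t) (at t within A)"
  unfolding optimal_control_def optimal_control'_def
  by (intro has_vector_derivative_add has_vector_derivative_mult_right has_vector_derivative_cos_sin)

lemma continuous_on_optimal_control': "continuous_on A optimal_control'"
  unfolding optimal_control'_def by (intro continuous_intros)

lemma optimal_control_periodic: "optimal_control (t + p) = optimal_control t"
  by (simp add: optimal_control_def cos_periodic)

lemma control_deriv_optimal_control:
  assumes "t \<in> {0..p}"
  shows "control_deriv \<omega> optimal_control t = optimal_control' t"
  using vector_derivative_within_cbox[of 0 p t optimal_control "optimal_control' t"] assms pos'
    optimal_control_has_derivative by (simp add: control_deriv_def flip: p_def)

lemma admissible_optimal_control: "admissible_control \<omega> optimal_control"
  unfolding admissible_control_def p_def[symmetric]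
proof (intro conjI allI)
  show "optimal_control differentiable_on {0..p}"
    using optimal_control_has_derivative
    by (auto simp: differentiable_on_def differentiable_def has_vector_derivative_def)
  show "continuous_on {0..p} (control_deriv \<omega> optimal_control)"
    by (subst continuous_on_cong[OF refl control_deriv_optimal_control])
      (auto intro: continuous_on_optimal_control')
qed (rule optimal_control_periodic)

section \<open>Reduction of the objective to the first-order work, and maximality\<close>

lemma integral_control_deriv:
  assumes "admissible_control \<omega> u"
  shows "(control_deriv \<omega> u has_integral 0) {0..p}"
proof -
  have "u p = u 0" using assms by (metis add_0 admissible_control_def p_def)
  then show ?thesis
    using fundamental_theorem_of_calculus[of 0 p u "control_deriv \<omega> u"] pos'
      admissible_control_has_derivative[OF assms] by simp
qed

text \<open>The term of order \<open>\<epsilon>\<close> drops out: \<open>sigma0\<close> is constant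
  in time, and the derivative of a control integrates to zero over a period.\<close>

lemma second_order_objective_eq:
  assumes u: "admissible_control \<omega> u" and s: "solves (first_order_forcing u) s"
  shows "second_order_objective m \<gamma> kB \<omega> q0 T0 T1 \<epsilon> u =
    - (\<omega> / (4 * pi)) * (\<epsilon>\<^sup>2 * integral {0..p} (\<lambda>t. control_deriv \<omega> u t * fst (s t)))"
proof -
  have "continuous_on {0..p} (\<lambda>t. control_deriv \<omega> u t * fst (s t))"
    using u periodic_solution_continuous[OF s]
    by (intro continuous_intros) (auto simp: admissible_control_def p_def)
  then have "((\<lambda>t. \<epsilon> * fst equilibrium * control_deriv \<omega> u t
        + \<epsilon>\<^sup>2 * (control_deriv \<omega> u t * fst (s t))) has_integral
      (\<epsilon> * fst equilibrium * 0 + \<epsilon>\<^sup>2 * integral {0..p} (\<lambda>t. control_deriv \<omega> u t * fst (s t)))) {0..p}"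
    by (intro has_integral_add has_integral_mult_right integral_control_deriv[OF u] integrable_integral
        integrable_continuous_interval)
  from integral_unique[OF this] show ?thesis
    unfolding second_order_objective_def p_def[symmetric] sigma0_eq sigma1_eq[OF u s]
    by (simp add: ac_simps)
qed

lemma optimal_control_maximal:
  assumes "admissible_control \<omega> u"
  shows "second_order_objective m \<gamma> kB \<omega> q0 T0 T1 \<epsilon> u
    \<le> second_order_objective m \<gamma> kB \<omega> q0 T0 T1 \<epsilon> optimal_control"
proof -
  obtain s where s: "solves (first_order_forcing u) s"
    using ex1_first_order[of u] admissible_control_continuous[OF assms] assms
    unfolding admissible_control_def p_def by blast
  have per: "v p = v 0" if "admissible_control \<omega> v" for v
    using that by (metis add_0 admissible_control_def p_def)
  have cont: "continuous_on {0..p} (control_deriv \<omega> v)" if "admissible_control \<omega> v" for v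
    using that by (simp add: admissible_control_def p_def)
  have "integral {0..p} (\<lambda>t. control_deriv \<omega> optimal_control t * fst (optimal_response t))
      \<le> integral {0..p} (\<lambda>t. control_deriv \<omega> u t * fst (s t))"
    by (rule work_le_stationary_work[OF _ _ _ _ _ _ s solves_optimal_response optimal_response_stationary])
      (use assms admissible_optimal_control admissible_control_has_derivative per cont in blast)+
  then have "\<omega> / (4 * pi) * (\<epsilon>\<^sup>2 * integral {0..p} (\<lambda>t. control_deriv \<omega> optimal_control t * fst (optimal_response t)))
      \<le> \<omega> / (4 * pi) * (\<epsilon>\<^sup>2 * integral {0..p} (\<lambda>t. control_deriv \<omega> u t * fst (s t)))"
    using pos by (intro mult_left_mono) auto
  then show ?thesis
    unfolding second_order_objective_eq[OF assms s]
      second_order_objective_eq[OF admissible_optimal_control solves_optimal_response] by simp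
qed

section \<open>Work of the optimal control over one period\<close>

lemma integral_trigonometric_product:
  "((\<lambda>t. \<omega> * (Q * cos (\<omega> * t) - P * sin (\<omega> * t)) * (X * cos (\<omega> * t) + Y * sin (\<omega> * t)))
     has_integral pi * (Q * X - P * Y)) {0..p}"
proof -
  \<comment> \<open>An antiderivative from the double-angle formulas; the sine terms vanish at 0 and
    \<open>p\<close>, so only the part linear in \<open>t\<close> contributes.\<close>
  define F where "F t = \<omega> * (Q * X - P * Y) / 2 * t
      + (Q * X + P * Y) / 2 * (sin (\<omega> * t) * cos (\<omega> * t))
      + (Q * Y - P * X) / 2 * (sin (\<omega> * t) * sin (\<omega> * t))" for t
  have "(F has_vector_derivative
      (\<omega> * (Q * cos (\<omega> * t) - P * sin (\<omega> * t)) * (X * cos (\<omega> * t) + Y * sin (\<omega> * t)))) (at t within {0..p})" for t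
  proof -
    have cs: "cos (\<omega> * t) * cos (\<omega> * t) = 1 - sin (\<omega> * t) * sin (\<omega> * t)"
      by (metis cos_squared_eq power2_eq_square)
    have "(F has_vector_derivative (\<omega> * (Q * X - P * Y) / 2 * 1
        + (Q * X + P * Y) / 2 * (sin (\<omega> * t) * (- \<omega> * sin (\<omega> * t)) + (\<omega> * cos (\<omega> * t)) * cos (\<omega> * t))
        + (Q * Y - P * X) / 2 * (sin (\<omega> * t) * (\<omega> * cos (\<omega> * t)) + (\<omega> * cos (\<omega> * t)) * sin (\<omega> * t))))
        (at t within {0..p})"
      unfolding F_def
      by (intro has_vector_derivative_add has_vector_derivative_mult_right has_vector_derivative_mult
          has_vector_derivative_cos_sin has_vector_derivative_id)
    moreover have "\<omega> * (Q * X - P * Y) / 2 * 1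
        + (Q * X + P * Y) / 2 * (sin (\<omega> * t) * (- \<omega> * sin (\<omega> * t)) + (\<omega> * cos (\<omega> * t)) * cos (\<omega> * t))
        + (Q * Y - P * X) / 2 * (sin (\<omega> * t) * (\<omega> * cos (\<omega> * t)) + (\<omega> * cos (\<omega> * t)) * sin (\<omega> * t))
      = \<omega> * (Q * cos (\<omega> * t) - P * sin (\<omega> * t)) * (X * cos (\<omega> * t) + Y * sin (\<omega> * t))"
      using cs by algebra
    ultimately show ?thesis by simp
  qed
  moreover have "F p - F 0 = pi * (Q * X - P * Y)"
    using pos cos_periodic(2)[of 0] by (simp add: F_def p_def)
  ultimately show ?thesis
    using fundamental_theorem_of_calculus[of 0 p F] pos' by force
qed

lemma integral_optimal_work:
  "((\<lambda>t. optimal_control' t * fst (optimal_response t)) has_integral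
     - (pi * (2 * \<kappa>\<^sup>2 * a) / (c * \<omega> * (\<omega>\<^sup>2 + 4 * k + 4 * a\<^sup>2)))) {0..p}"
proof -
  define E where "E = \<omega>\<^sup>2 + 4 * k + 4 * a\<^sup>2"
  have E: "E > 0" unfolding E_def by (rule denominator_pos)
  have fold: "\<omega>\<^sup>2 + 4 * k + 4 * a\<^sup>2 = E" by (simp add: E_def)
  define P Q where "P = \<kappa> / (c * E) * (2 * a\<^sup>2 + 4 * k - \<omega>\<^sup>2)"
    and "Q = \<kappa> / (c * E) * (3 * a * \<omega> - 4 * a * k / \<omega>)"
  define X Y where "X = - 2 * (\<kappa> / E)" and "Y = \<kappa> / E * (4 * a / \<omega>)"
  have "optimal_control' t = \<omega> * (Q * cos (\<omega> * t) - P * sin (\<omega> * t))" for t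
    unfolding optimal_control'_def fold P_def Q_def by algebra
  moreover have "fst (optimal_response t) = X * cos (\<omega> * t) + Y * sin (\<omega> * t)" for t
    unfolding optimal_response_def fold X_def Y_def scaleR_Pair fst_conv real_scaleR_def by algebra
  moreover have "Q * X - P * Y = - (2 * \<kappa>\<^sup>2 * a / (c * \<omega> * E))"
  proof -
    \<comment> \<open>The numerator reproduces \<open>E\<close> as a factor, cancelling one of the
      two powers in the denominator.\<close>
    have "Q * X - P * Y = - (\<kappa>\<^sup>2 / (c * E\<^sup>2) * (2 * a / \<omega>) * (\<omega>\<^sup>2 + 4 * k + 4 * a\<^sup>2))"
      using pos pos' E by (simp add: P_def Q_def X_def Y_def field_simps power2_eq_square)
    then show ?thesis
      using pos pos' E unfolding fold by (simp add: field_simps power2_eq_square)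
  qed
  ultimately show ?thesis
    using integral_trigonometric_product[of Q P X Y] by (simp add: fold)
qed

subsection \<open>Expansion of the power output\<close>

text \<open>The linear bound is used twice. It first shows that \<open>s - equilibrium\<close> is of
  order \<open>\<epsilon>\<close>. After subtracting \<open>\<epsilon> *\<^sub>R s1\<close>, the
  remaining forcing is exactly the gain perturbation applied to \<open>s - equilibrium\<close>,
  hence of order \<open>\<epsilon>\<^sup>2\<close>.\<close>

lemma cyclic_covariance_expansion:
  assumes cont: "continuous_on UNIV u" and per: "\<And>t. u (t + p) = u t"
    and s1: "solves (first_order_forcing u) s1"
  obtains \<epsilon>0 K where "\<epsilon>0 > 0"
    and "\<And>\<epsilon>. 0 < \<epsilon> \<Longrightarrow> \<epsilon> < \<epsilon>0 \<Longrightarrow> \<exists>!s. solves (\<lambda>t. forcing \<epsilon> u t (s t)) s"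
    and "\<And>\<epsilon> s t. 0 < \<epsilon> \<Longrightarrow> \<epsilon> < \<epsilon>0 \<Longrightarrow> solves (\<lambda>t. forcing \<epsilon> u t (s t)) s \<Longrightarrow>
      norm (s t - equilibrium - \<epsilon> *\<^sub>R s1 t) \<le> K * \<epsilon>\<^sup>2"
proof -
  obtain C where C: "C \<ge> 0" "\<And>g s B t. solves g s \<Longrightarrow> (\<And>t. norm (g t) \<le> B) \<Longrightarrow> norm (s t) \<le> C * B"
    using solves_bound by metis
  obtain t0 where "\<And>t. norm (u t) \<le> norm (u t0)"
    using periodic_attains_norm_max[of p u] pos' per cont by blast
  define n where "n = 3 * (\<bar>u t0\<bar> / m)"
  have n: "n \<ge> 0" using pos by (simp add: n_def)
  have gain: "norm (gain_map (\<epsilon> * u t / m) v) \<le> \<epsilon> * n * norm v" if "\<epsilon> > 0" for \<epsilon> t v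
  proof -
    have "3 * \<bar>\<epsilon> * u t / m\<bar> \<le> \<epsilon> * n"
      using \<open>norm (u t) \<le> norm (u t0)\<close> that pos by (simp add: n_def abs_mult divide_right_mono)
    then show ?thesis
      using norm_gain_map[of "\<epsilon> * u t / m" v] mult_right_mono[of _ _ "norm v"] by force
  qed
  define H where "H = \<bar>T1 * (2 * \<gamma> * kB / m\<^sup>2)\<bar>"
  have noise: "norm (noise (T1 * cos (\<omega> * t))) \<le> H" for t
  proof -
    have "norm (noise (T1 * cos (\<omega> * t))) = H * \<bar>cos (\<omega> * t)\<bar>"
      by (simp add: noise_def H_def norm_Pair abs_mult)
    also have "\<dots> \<le> H * 1"
      by (intro mult_left_mono) (auto simp: H_def)
    finally show ?thesis by simp
  qed
  \<comment> \<open>Chosen so that \<open>C * (\<epsilon> * n) \<le> 1 / 2\<close> for smaller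
    \<open>\<epsilon>\<close>; the summand 1 keeps the denominator positive when
    \<open>C * n = 0\<close>.\<close>
  define \<epsilon>0 where "\<epsilon>0 = 1 / (2 * (C * n + 1))"
  define K where "K = C * n * (2 * C * (H + n * norm equilibrium))"
  have "C * n \<ge> 0" using C(1) n by simp
  have small: "C * (\<epsilon> * n) \<le> 1 / 2" if "0 < \<epsilon>" "\<epsilon> < \<epsilon>0" for \<epsilon>
  proof -
    have "\<epsilon> * (2 * (C * n + 1)) \<le> 1"
      using that \<open>C * n \<ge> 0\<close> by (simp add: \<epsilon>0_def pos_less_divide_eq)
    then show ?thesis using that by (simp add: algebra_simps)
  qed
  have 1: "\<epsilon>0 > 0" using \<open>C * n \<ge> 0\<close> by (simp add: \<epsilon>0_def)
  have 2: "\<exists>!s. solves (\<lambda>t. forcing \<epsilon> u t (s t)) s" if "0 < \<epsilon>" "\<epsilon> < \<epsilon>0" for \<epsilon>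
  proof (rule ex1_periodic_solution_of_Lipschitz_forcing[where C = C and n = "\<epsilon> * n"])
    show "norm (forcing \<epsilon> u t v - forcing \<epsilon> u t w) \<le> \<epsilon> * n * norm (v - w)" for t v w
      using gain[OF that(1)] by (simp add: forcing_def gain_map_diff)
    show "forcing \<epsilon> u (t + p) v = forcing \<epsilon> u t v" for t v
      by (simp add: forcing_def cos_periodic per)
    show "continuous_on UNIV (\<lambda>t. forcing \<epsilon> u t (s t))" if "continuous_on UNIV s" for s
      unfolding forcing_def noise_def using pos
      by (intro continuous_intros continuous_on_gain_map that cont) auto
    show "C * (\<epsilon> * n) < 1" using small[OF that] by simp
    show "0 \<le> \<epsilon> * n" using that n by simp
    show "norm (s t) \<le> C * B" if "solves g s" "\<And>t. norm (g t) \<le> B" for g s B t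
      by (rule C(2)[OF that])
    show "\<exists>s. solves g s" if "continuous_on UNIV g" "\<And>t. g (t + p) = g t" for g
      by (rule moment_map_solution_exists[OF pos'(1-3) that])
  qed (use C(1) pos' in \<open>auto simp: linear_moment_map\<close>)
  have 3: "norm (s t - equilibrium - \<epsilon> *\<^sub>R s1 t) \<le> K * \<epsilon>\<^sup>2"
    if \<epsilon>: "0 < \<epsilon>" "\<epsilon> < \<epsilon>0" and s: "solves (\<lambda>t. forcing \<epsilon> u t (s t)) s" for \<epsilon> s t
  proof -
    have noise_add: "noise (T + \<epsilon> * T') = noise T + \<epsilon> *\<^sub>R noise T'" for T T'
      by (simp add: noise_def add_divide_distrib algebra_simps)
    have d: "solves (\<lambda>t. forcing \<epsilon> u t (s t) - noise T0) (\<lambda>t. s t - equilibrium)"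
      by (rule periodic_solution_diff[OF linear_moment_map s solves_equilibrium])
    obtain t1 where t1: "\<And>t. norm (s t - equilibrium) \<le> norm (s t1 - equilibrium)"
      using periodic_attains_norm_max[of p "\<lambda>t. s t - equilibrium"] pos'
        periodic_solutionD(1)[OF d] periodic_solution_continuous[OF d] by blast
    define D where "D = norm (s t1 - equilibrium)"
    have "norm (forcing \<epsilon> u t (s t) - noise T0) \<le> \<epsilon> * (H + n * (norm equilibrium + D))" for t
    proof -
      have "forcing \<epsilon> u t (s t) - noise T0 = \<epsilon> *\<^sub>R noise (T1 * cos (\<omega> * t)) + gain_map (\<epsilon> * u t / m) (s t)"
        by (simp add: forcing_def noise_add mult.assoc)
      also have "norm \<dots> \<le> \<epsilon> * H + \<epsilon> * n * norm (s t)"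
        using gain[OF \<epsilon>(1)] noise \<epsilon>(1) by (intro norm_triangle_mono) (auto intro: mult_left_mono)
      also have "\<dots> \<le> \<epsilon> * H + \<epsilon> * n * (norm equilibrium + D)"
        using norm_triangle_sub[of "s t" equilibrium] t1[of t] n \<epsilon>(1)
        by (intro add_left_mono mult_left_mono) (auto simp: D_def)
      finally show ?thesis by (simp add: algebra_simps)
    qed
    from C(2)[OF d this] have "D \<le> C * (\<epsilon> * (H + n * (norm equilibrium + D)))"
      by (simp add: D_def)
    also have "\<dots> = C * \<epsilon> * (H + n * norm equilibrium) + C * (\<epsilon> * n) * D"
      by (simp add: algebra_simps)
    \<comment> \<open>The half of \<open>D\<close> on the right is absorbed into the left side,
      which doubles the constant.\<close>
    also have "\<dots> \<le> C * \<epsilon> * (H + n * norm equilibrium) + 1 / 2 * D"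
      using small[OF \<epsilon>] by (intro add_left_mono mult_right_mono) (auto simp: D_def)
    finally have D: "D \<le> 2 * C * (H + n * norm equilibrium) * \<epsilon>"
      by (simp add: algebra_simps)
    have s1': "solves (\<lambda>t. \<epsilon> *\<^sub>R first_order_forcing u t) (\<lambda>t. \<epsilon> *\<^sub>R s1 t)"
      using periodic_solutionD(1)[OF s1]
        bounded_linear.has_vector_derivative[OF bounded_linear_scaleR_right periodic_solutionD(2)[OF s1]]
      by (simp add: periodic_solution_def linear_scale[OF linear_moment_map] scaleR_add_right)
    have "norm (forcing \<epsilon> u t (s t) - noise T0 - \<epsilon> *\<^sub>R first_order_forcing u t) \<le> \<epsilon> * n * D" for t
    proof -
      have "forcing \<epsilon> u t (s t) - noise T0 - \<epsilon> *\<^sub>R first_order_forcing u t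
          = gain_map (\<epsilon> * u t / m) (s t - equilibrium)"
        using gain_map_scale[of \<epsilon> "u t / m" equilibrium]
        by (simp add: forcing_def first_order_forcing_def noise_add mult.assoc scaleR_add_right
            flip: gain_map_diff)
      also have "norm \<dots> \<le> \<epsilon> * n * norm (s t - equilibrium)"
        by (rule gain[OF \<epsilon>(1)])
      also have "\<dots> \<le> \<epsilon> * n * D"
        using t1[of t] n \<epsilon>(1) unfolding D_def by (intro mult_left_mono) auto
      finally show ?thesis .
    qed
    from C(2)[OF periodic_solution_diff[OF linear_moment_map d s1'] this]
    have "norm (s t - equilibrium - \<epsilon> *\<^sub>R s1 t) \<le> C * (\<epsilon> * n * D)" .
    also have "\<dots> \<le> C * (\<epsilon> * n * (2 * C * (H + n * norm equilibrium) * \<epsilon>))"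
      using D C(1) n \<epsilon>(1) by (intro mult_left_mono) auto
    finally show ?thesis by (simp add: K_def power2_eq_square ac_simps)
  qed
  show ?thesis
    by (rule that[of \<epsilon>0 K], rule 1, erule 2, assumption, erule 3)
qed

text \<open>The covariance splits into \<open>equilibrium\<close>, the first-order response and a
  remainder of order \<open>\<epsilon>\<^sup>2\<close>. The first does no work over a cycle, the
  second gives the stated coefficient, and the extra factor \<open>\<epsilon>\<close> of the control
  makes the remainder cubic.\<close>

lemma ex1_optimal_cyclic_covariance:
  "\<forall>\<^sub>F \<epsilon> in at_right 0. \<exists>!S. is_cyclic_covariance m \<gamma> kB \<omega> q0 T0 T1 \<epsilon> optimal_control S"
  and optimal_power_expansion:
  "(\<lambda>\<epsilon>. power_output m \<gamma> kB \<omega> q0 T0 T1 \<epsilon> optimal_control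
      - \<epsilon>\<^sup>2 * (\<kappa>\<^sup>2 * a / (2 * c * (\<omega>\<^sup>2 + 4 * k + 4 * a\<^sup>2)))) \<in> O[at_right 0](\<lambda>\<epsilon>. \<epsilon> ^ 3)"
proof -
  let ?u = optimal_control and ?u' = optimal_control'
  let ?V = "\<kappa>\<^sup>2 * a / (2 * c * (\<omega>\<^sup>2 + 4 * k + 4 * a\<^sup>2))"
  obtain \<epsilon>0 K where "\<epsilon>0 > 0"
    and ex1: "\<And>\<epsilon>. 0 < \<epsilon> \<Longrightarrow> \<epsilon> < \<epsilon>0 \<Longrightarrow> \<exists>!s. solves (\<lambda>t. forcing \<epsilon> ?u t (s t)) s"
    and expansion: "\<And>\<epsilon> s t. 0 < \<epsilon> \<Longrightarrow> \<epsilon> < \<epsilon>0 \<Longrightarrow> solves (\<lambda>t. forcing \<epsilon> ?u t (s t)) s \<Longrightarrow>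
      norm (s t - equilibrium - \<epsilon> *\<^sub>R optimal_response t) \<le> K * \<epsilon>\<^sup>2"
    by (rule cyclic_covariance_expansion[OF admissible_control_continuous[OF admissible_optimal_control]
          optimal_control_periodic solves_optimal_response]) (rule that; assumption)
  have small: "\<forall>\<^sub>F \<epsilon> in at_right 0. 0 < \<epsilon> \<and> \<epsilon> < \<epsilon>0"
    using \<open>\<epsilon>0 > 0\<close> eventually_at_right[of 0 \<epsilon>0] by auto
  show "\<forall>\<^sub>F \<epsilon> in at_right 0. \<exists>!S. is_cyclic_covariance m \<gamma> kB \<omega> q0 T0 T1 \<epsilon> ?u S"
    using small
  proof eventually_elim
    case (elim \<epsilon>)
    show ?case
      by (rule ex1_and_the_of_moments(1)[OF is_cyclic_covariance_iff ex1]) (use elim in auto)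
  qed
  obtain B where B: "\<And>t. t \<in> {0..p} \<Longrightarrow> norm (?u' t) \<le> B"
    using compact_continuous_image[OF continuous_on_optimal_control' compact_Icc, of 0 p]
    by (metis bounded_iff compact_imp_bounded imageI)
  have "B \<ge> 0" using order_trans[OF norm_ge_zero B[of 0]] pos' by simp
  have "norm (power_output m \<gamma> kB \<omega> q0 T0 T1 \<epsilon> ?u - \<epsilon>\<^sup>2 * ?V) \<le> \<omega> / (4 * pi) * (B * K * p) * norm (\<epsilon> ^ 3)"
    if \<epsilon>: "0 < \<epsilon>" "\<epsilon> < \<epsilon>0" for \<epsilon>
  proof -
    obtain s where s: "solves (\<lambda>t. forcing \<epsilon> ?u t (s t)) s"
      using ex1[OF \<epsilon>] by blast
    have "cyclic_covariance m \<gamma> kB \<omega> q0 T0 T1 \<epsilon> ?u = (\<lambda>t. sym_mat (s t))"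
      unfolding cyclic_covariance_def
      by (rule ex1_and_the_of_moments(2)[OF is_cyclic_covariance_iff ex1[OF \<epsilon>] s])
    moreover have "integral {0..p} (\<lambda>t. \<epsilon> * control_deriv \<omega> ?u t * fst (s t))
        = integral {0..p} (\<lambda>t. \<epsilon> * ?u' t * fst (s t))"
      by (rule integral_cong) (simp add: control_deriv_optimal_control)
    ultimately have power: "power_output m \<gamma> kB \<omega> q0 T0 T1 \<epsilon> ?u
        = - (\<omega> / (4 * pi)) * integral {0..p} (\<lambda>t. \<epsilon> * ?u' t * fst (s t))"
      unfolding power_output_def p_def[symmetric]
      by simp
    define r where "r t = \<epsilon> * ?u' t * fst (s t - equilibrium - \<epsilon> *\<^sub>R optimal_response t)" for t
    have r_cont: "continuous_on {0..p} r"
      unfolding r_def by (intro continuous_intros continuous_on_optimal_control'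
          periodic_solution_continuous[OF s] periodic_solution_continuous[OF solves_optimal_response])
    have "norm (r t) \<le> \<epsilon> * B * (K * \<epsilon>\<^sup>2)" if "t \<in> {0..p}" for t
    proof -
      have "norm (fst (s t - equilibrium - \<epsilon> *\<^sub>R optimal_response t)) \<le> K * \<epsilon>\<^sup>2"
        using order_trans[OF _ expansion[OF \<epsilon> s]] norm_fst_le by (metis prod.collapse)
      then show ?thesis
        using B[OF that] \<epsilon>(1) \<open>B \<ge> 0\<close> unfolding r_def norm_mult
        by (intro mult_mono) auto
    qed
    from integral_bound[OF _ r_cont this]
    have r_bound: "norm (integral {0..p} r) \<le> \<epsilon> * B * (K * \<epsilon>\<^sup>2) * p"
      using pos' by simp
    have "(?u' has_integral 0) {0..p}"
      using has_integral_eq[OF _ integral_control_deriv[OF admissible_optimal_control]]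
        control_deriv_optimal_control by blast
    then have "((\<lambda>t. \<epsilon> * fst equilibrium * ?u' t + \<epsilon>\<^sup>2 * (?u' t * fst (optimal_response t)) + r t)
        has_integral (\<epsilon> * fst equilibrium * 0
          + \<epsilon>\<^sup>2 * - (pi * (2 * \<kappa>\<^sup>2 * a) / (c * \<omega> * (\<omega>\<^sup>2 + 4 * k + 4 * a\<^sup>2)))
          + integral {0..p} r)) {0..p}"
      by (intro has_integral_add has_integral_mult_right integral_optimal_work integrable_integral
          integrable_continuous_interval r_cont)
    moreover have "\<epsilon> * fst equilibrium * ?u' t + \<epsilon>\<^sup>2 * (?u' t * fst (optimal_response t)) + r t
        = \<epsilon> * ?u' t * fst (s t)" for t
      by (simp add: r_def algebra_simps power2_eq_square)
    ultimately have work: "integral {0..p} (\<lambda>t. \<epsilon> * ?u' t * fst (s t))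
        = \<epsilon>\<^sup>2 * - (pi * (2 * \<kappa>\<^sup>2 * a) / (c * \<omega> * (\<omega>\<^sup>2 + 4 * k + 4 * a\<^sup>2))) + integral {0..p} r"
      by (simp add: integral_unique)
    \<comment> \<open>Stated for arbitrary \<open>E\<close> and \<open>R\<close> so that the
      denominator and the remainder integral enter the cancellation as atoms.\<close>
    have "- (\<omega> / (4 * pi)) * (\<epsilon>\<^sup>2 * - (pi * (2 * \<kappa>\<^sup>2 * a) / (c * \<omega> * E)) + R)
        - \<epsilon>\<^sup>2 * (\<kappa>\<^sup>2 * a / (2 * c * E)) = - (\<omega> / (4 * pi)) * R" if "E > 0" for E R
      using pos pos' that by (simp add: field_simps)
    from this[OF denominator_pos, of "integral {0..p} r"]
    have "power_output m \<gamma> kB \<omega> q0 T0 T1 \<epsilon> ?u - \<epsilon>\<^sup>2 * ?V = - (\<omega> / (4 * pi)) * integral {0..p} r"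
      unfolding power work .
    then have "norm (power_output m \<gamma> kB \<omega> q0 T0 T1 \<epsilon> ?u - \<epsilon>\<^sup>2 * ?V)
        = \<omega> / (4 * pi) * norm (integral {0..p} r)"
      using pos by (simp add: abs_mult)
    also have "\<dots> \<le> \<omega> / (4 * pi) * (\<epsilon> * B * (K * \<epsilon>\<^sup>2) * p)"
      using pos by (intro mult_left_mono r_bound) auto
    finally show ?thesis
      using \<epsilon>(1) by (simp add: power2_eq_square power3_eq_cube ac_simps)
  qed
  then show "(\<lambda>\<epsilon>. power_output m \<gamma> kB \<omega> q0 T0 T1 \<epsilon> ?u - \<epsilon>\<^sup>2 * ?V) \<in> O[at_right 0](\<lambda>\<epsilon>. \<epsilon> ^ 3)"
    by (intro bigoI[of _ "\<omega> / (4 * pi) * (B * K * p)"] eventually_mono[OF small]) blast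
qed

end

text \<open>The covariances in the objective and the power are definite descriptions; the three
  unique-existence claims ensure that they denote actual periodic solutions, for the exact one once
  \<open>\<epsilon>\<close> is small enough.\<close>

theorem theorem2:
  fixes m \<gamma> kB \<omega> q0 T0 T1 \<alpha> \<beta> q1 \<phi> :: real and ustar :: "real \<Rightarrow> real"
  assumes "m > 0" and "\<gamma> > 0" and "kB > 0" and "\<omega> > 0" and "q0 > 0"
    and "T0 > T1" and "T1 \<ge> 0"
    and "\<alpha> = 4 * q0 * \<gamma> - 3 * \<omega>\<^sup>2 * \<gamma> * m"
    and "\<beta> = \<omega> * (2 * \<gamma>\<^sup>2 + 4 * q0 * m - \<omega>\<^sup>2 * m\<^sup>2)"
    and "q1 = q0 * \<gamma> * T1 * sqrt (\<alpha>\<^sup>2 + \<beta>\<^sup>2) / (T0 * (2 * \<gamma> * \<beta> - \<alpha> * \<omega> * m))"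
    and "\<phi> = Arg (complex_of_real \<beta> - \<i> * complex_of_real \<alpha>)"
    and "ustar = (\<lambda>t. q1 * cos (\<omega> * t - \<phi>))"
  shows "(\<exists>!S. is_sigma0 m \<gamma> kB \<omega> q0 T0 S)
    \<and> (\<forall>u. admissible_control \<omega> u \<longrightarrow> (\<exists>!S. is_sigma1 m \<gamma> kB \<omega> q0 T0 T1 u S))
    \<and> admissible_control \<omega> ustar
    \<and> (\<forall>\<epsilon>>0. \<forall>u. admissible_control \<omega> u \<longrightarrow>
          second_order_objective m \<gamma> kB \<omega> q0 T0 T1 \<epsilon> u
            \<le> second_order_objective m \<gamma> kB \<omega> q0 T0 T1 \<epsilon> ustar)
    \<and> (\<forall>\<^sub>F \<epsilon> in at_right 0. \<exists>!S. is_cyclic_covariance m \<gamma> kB \<omega> q0 T0 T1 \<epsilon> ustar S)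
    \<and> (\<lambda>\<epsilon>. power_output m \<gamma> kB \<omega> q0 T0 T1 \<epsilon> ustar
            - \<epsilon>\<^sup>2 * (q0 * \<omega> * kB * \<gamma>\<^sup>2 * T1\<^sup>2 / (2 * T0 * (2 * \<gamma> * \<beta> - \<alpha> * \<omega> * m))))
        \<in> O[at_right 0](\<lambda>\<epsilon>. \<epsilon> ^ 3)"
proof -
  interpret langevin_cycle m \<gamma> kB \<omega> q0 T0 T1
    using assms(1-7) by unfold_locales auto
  define E where "E = \<omega>\<^sup>2 + 4 * k + 4 * a\<^sup>2"
  have E: "E > 0" unfolding E_def by (rule denominator_pos)
  have \<alpha>: "\<alpha> = m\<^sup>2 * (4 * k * a - 3 * \<omega>\<^sup>2 * a)"
    and \<beta>: "\<beta> = m\<^sup>2 * \<omega> * (2 * a\<^sup>2 + 4 * k - \<omega>\<^sup>2)"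
    using pos by (simp_all add: assms(8,9) a_def k_def field_simps power2_eq_square)
  \<comment> \<open>This also shows that the denominator in the amplitude and in the power is
    positive.\<close>
  have denom: "2 * \<gamma> * \<beta> - \<alpha> * \<omega> * m = \<omega> * \<gamma> * m\<^sup>2 * E"
    using pos by (simp add: assms(8,9) E_def a_def k_def field_simps power2_eq_square)
  \<comment> \<open>Polar coordinates of \<open>\<beta> - \<i> \<alpha>\<close>; its negative
    imaginary part accounts for the sign in the second equation.\<close>
  have r: "sqrt (\<alpha>\<^sup>2 + \<beta>\<^sup>2) * cos \<phi> = \<beta>" "sqrt (\<alpha>\<^sup>2 + \<beta>\<^sup>2) * sin \<phi> = - \<alpha>"
  proof -
    have z: "complex_of_real \<beta> - \<i> * complex_of_real \<alpha> = Complex \<beta> (- \<alpha>)"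
      by (simp add: complex_eq_iff)
    have "rcis (cmod (Complex \<beta> (- \<alpha>))) \<phi> = Complex \<beta> (- \<alpha>)"
      unfolding assms(11) z using rcis_cmod_Arg by blast
    then show "sqrt (\<alpha>\<^sup>2 + \<beta>\<^sup>2) * cos \<phi> = \<beta>" "sqrt (\<alpha>\<^sup>2 + \<beta>\<^sup>2) * sin \<phi> = - \<alpha>"
      by (simp_all add: complex_eq_iff rcis_def cmod_def add.commute)
  qed
  have amplitude: "q0 * \<gamma> * T1 / (T0 * (2 * \<gamma> * \<beta> - \<alpha> * \<omega> * m)) = \<kappa> / (c * E) / (m\<^sup>2 * \<omega>)"
    unfolding denom using pos E by (simp add: \<kappa>_def c_def field_simps power2_eq_square)
  have ustar: "ustar = optimal_control"
  proof
    fix t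
    define R where "R = \<kappa> / (c * E) / (m\<^sup>2 * \<omega>)"
    have "q1 = R * sqrt (\<alpha>\<^sup>2 + \<beta>\<^sup>2)"
      unfolding assms(10) R_def amplitude[symmetric] by simp
    then have "ustar t = R * (sqrt (\<alpha>\<^sup>2 + \<beta>\<^sup>2) * cos \<phi> * cos (\<omega> * t) + sqrt (\<alpha>\<^sup>2 + \<beta>\<^sup>2) * sin \<phi> * sin (\<omega> * t))"
      by (simp add: assms(12) cos_diff algebra_simps)
    also have "\<dots> = R * (\<beta> * cos (\<omega> * t) - \<alpha> * sin (\<omega> * t))"
      unfolding r by simp
    also have "\<beta> * cos (\<omega> * t) - \<alpha> * sin (\<omega> * t) = m\<^sup>2 * \<omega> *
        ((2 * a\<^sup>2 + 4 * k - \<omega>\<^sup>2) * cos (\<omega> * t) + (3 * a * \<omega> - 4 * a * k / \<omega>) * sin (\<omega> * t))"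
      unfolding \<alpha> \<beta> using pos by (simp add: field_simps power2_eq_square)
    finally show "ustar t = optimal_control t"
      using pos by (simp add: R_def optimal_control_def E_def)
  qed
  have coefficient: "q0 * \<omega> * kB * \<gamma>\<^sup>2 * T1\<^sup>2 / (2 * T0 * (2 * \<gamma> * \<beta> - \<alpha> * \<omega> * m)) = \<kappa>\<^sup>2 * a / (2 * c * E)"
    unfolding denom using pos E by (simp add: \<kappa>_def c_def a_def field_simps power2_eq_square)
  show ?thesis
    unfolding ustar coefficient E_def
    using ex1_sigma0 ex1_sigma1 admissible_optimal_control optimal_control_maximal
      ex1_optimal_cyclic_covariance optimal_power_expansion by blast
qed

end
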